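(* Let $L$ be a finite-dimensional solvable Lie algebra over a field $F$ and let $n$ be a positive integer. Then $L \in \mathcal{N}(n)$ if and only if there are nilpotent subalgebras $B_i$ of $L$ for $i=1,\ldots,n$ such that (i) $N_i(L)=B_1+\cdots +B_i$ for $i=1,\ldots, n$, (ii) $L=B_1+\cdots +B_n$, (iii) $[B_i,B_j]\subseteq B_i$ for $1\leq i\leq j\leq n$, and (iv) $N_i(L)\cap U_i\subseteq \phi(U_i)=\phi_{i+1}(L)\cap U_i$, where $U_i= B_{i+1}+\cdots +B_n$, for $i=1,\ldots,n-1$.
   Context: $N(L)$ is the nilradical of $L$; the upper nilpotent series is $N_0(L)=0$, $N_i(L)/N_{i-1}(L)=N(L/N_{i-1}(L))$, and the nilpotent length of $L$ is the smallest integer $m$ with $N_m(L)=L$. $\mathcal{N}(n)$ is the class of (finite-dimensional solvable) Lie algebras of nilpotent length exactly $n$. The Frattini subalgebra $\phi(L)$ is the intersection of the maximal subalgebras of $L$ (an ideal, since $L$ is solvable), and the Frattini series is given by $\phi_i(L)/N_{i-1}(L)=\phi(L/N_{i-1}(L))$ for $i=1,2,\ldots$.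
   Formalization: The nilpotent subalgebras B_i are required to be nonzero; if zero B_i are allowed the "if" direction fails (e.g. L=0, n=1, B_1=0, or L nonzero nilpotent, n=2, B_1=L, B_2=0). *)

theory Defs
  imports "HOL-Algebra.Module" "HOL-Algebra.QuotRing"
begin

section \<open>Lie algebras over a field\<close>

text \<open>
  A Lie algebra is a record with explicit carrier, so that subalgebras and quotients are again
  records of the same kind.  The record \<open>module\<close> extends \<open>ring\<close>; as for \<^locale>\<open>module\<close>, the ring
  multiplication and unit of the record \<open>L\<close> play no role, and the Lie product is the component \<open>lie_bracket\<close>.
\<close>

record ('a, 'b) lie_algebra = "('a, 'b) module" +
  lie_bracket :: "'b \<Rightarrow> 'b \<Rightarrow> 'b"

locale lie_algebra = module F L + field F
  for F :: "('a, 'c) ring_scheme" (structure)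
    and L :: "('a, 'b, 'd) lie_algebra_scheme" (structure) +
  assumes lie_closed:
      "\<lbrakk>x \<in> carrier L; y \<in> carrier L\<rbrakk> \<Longrightarrow> lie_bracket L x y \<in> carrier L"
    and lie_add_left:
      "\<lbrakk>x \<in> carrier L; y \<in> carrier L; z \<in> carrier L\<rbrakk> \<Longrightarrow>
       lie_bracket L (x \<oplus>\<^bsub>L\<^esub> y) z = lie_bracket L x z \<oplus>\<^bsub>L\<^esub> lie_bracket L y z"
    and lie_add_right:
      "\<lbrakk>x \<in> carrier L; y \<in> carrier L; z \<in> carrier L\<rbrakk> \<Longrightarrow>
       lie_bracket L x (y \<oplus>\<^bsub>L\<^esub> z) = lie_bracket L x y \<oplus>\<^bsub>L\<^esub> lie_bracket L x z"
    and lie_smult_left: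
      "\<lbrakk>a \<in> carrier F; x \<in> carrier L; y \<in> carrier L\<rbrakk> \<Longrightarrow>
       lie_bracket L (a \<odot>\<^bsub>L\<^esub> x) y = a \<odot>\<^bsub>L\<^esub> lie_bracket L x y"
    and lie_smult_right:
      "\<lbrakk>a \<in> carrier F; x \<in> carrier L; y \<in> carrier L\<rbrakk> \<Longrightarrow>
       lie_bracket L x (a \<odot>\<^bsub>L\<^esub> y) = a \<odot>\<^bsub>L\<^esub> lie_bracket L x y"
    and lie_alternating:
      "x \<in> carrier L \<Longrightarrow> lie_bracket L x x = \<zero>\<^bsub>L\<^esub>"
    and lie_jacobi:
      "\<lbrakk>x \<in> carrier L; y \<in> carrier L; z \<in> carrier L\<rbrakk> \<Longrightarrow>
       lie_bracket L x (lie_bracket L y z) \<oplus>\<^bsub>L\<^esub> lie_bracket L y (lie_bracket L z x)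
         \<oplus>\<^bsub>L\<^esub> lie_bracket L z (lie_bracket L x y) = \<zero>\<^bsub>L\<^esub>"

definition finite_dimensional ::
    "('a, 'c) ring_scheme \<Rightarrow> ('a, 'b, 'd) module_scheme \<Rightarrow> bool" where
  "finite_dimensional F V \<longleftrightarrow>
     (\<exists>S. finite S \<and> S \<subseteq> carrier V \<and>
        carrier V = {(\<Oplus>\<^bsub>V\<^esub>s\<in>S. a s \<odot>\<^bsub>V\<^esub> s) | a. a \<in> S \<rightarrow> carrier F})"

definition subspace_sum ::
    "('a, 'b, 'd) module_scheme \<Rightarrow> 'i set \<Rightarrow> ('i \<Rightarrow> 'b set) \<Rightarrow> 'b set" where
  "subspace_sum V J B = {(\<Oplus>\<^bsub>V\<^esub>j\<in>J. b j) | b. b \<in> (\<Pi> j\<in>J. B j)}"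

definition subspace_span ::
    "('a, 'c) ring_scheme \<Rightarrow> ('a, 'b, 'd) module_scheme \<Rightarrow> 'b set \<Rightarrow> 'b set" where
  "subspace_span F V S = \<Inter>{H. submodule H F V \<and> S \<subseteq> H}"

definition lie_subalgebra ::
    "('a, 'c) ring_scheme \<Rightarrow> ('a, 'b, 'd) lie_algebra_scheme \<Rightarrow> 'b set \<Rightarrow> bool" where
  "lie_subalgebra F L H \<longleftrightarrow> submodule H F L \<and> (\<forall>x\<in>H. \<forall>y\<in>H. lie_bracket L x y \<in> H)"

definition lie_ideal ::
    "('a, 'c) ring_scheme \<Rightarrow> ('a, 'b, 'd) lie_algebra_scheme \<Rightarrow> 'b set \<Rightarrow> bool" where
  "lie_ideal F L I \<longleftrightarrow> submodule I F L \<and> (\<forall>x\<in>carrier L. \<forall>y\<in>I. lie_bracket L x y \<in> I)"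

abbreviation lie_restrict ::
    "('a, 'b, 'd) lie_algebra_scheme \<Rightarrow> 'b set \<Rightarrow> ('a, 'b, 'd) lie_algebra_scheme" where
  "lie_restrict L H \<equiv> L\<lparr>carrier := H\<rparr>"

text \<open>
  The quotient \<open>L / I\<close>, with the cosets of \<open>I\<close> as elements.  Scalar multiplication and bracket of
  cosets are defined in the same style as \<^const>\<open>rcoset_mult\<close>.
\<close>

definition lie_quotient ::
    "('a, 'b, 'd) lie_algebra_scheme \<Rightarrow> 'b set \<Rightarrow> ('a, 'b set) lie_algebra" where
  "lie_quotient L I =
     \<lparr>carrier = a_rcosets\<^bsub>L\<^esub> I, mult = undefined, one = undefined,
      zero = I, add = set_add L,
      smult = (\<lambda>a A. \<Union>x\<in>A. I +>\<^bsub>L\<^esub> (a \<odot>\<^bsub>L\<^esub> x)),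
      lie_bracket = (\<lambda>A B. \<Union>x\<in>A. \<Union>y\<in>B. I +>\<^bsub>L\<^esub> lie_bracket L x y)\<rparr>"

definition lie_product ::
    "('a, 'c) ring_scheme \<Rightarrow> ('a, 'b, 'd) lie_algebra_scheme \<Rightarrow> 'b set \<Rightarrow> 'b set \<Rightarrow> 'b set" where
  "lie_product F L A B = subspace_span F L {lie_bracket L a b | a b. a \<in> A \<and> b \<in> B}"

primrec lower_central_series ::
    "('a, 'c) ring_scheme \<Rightarrow> ('a, 'b, 'd) lie_algebra_scheme \<Rightarrow> nat \<Rightarrow> 'b set" where
  "lower_central_series F L 0 = carrier L"
| "lower_central_series F L (Suc k) = lie_product F L (carrier L) (lower_central_series F L k)"

primrec derived_series ::
    "('a, 'c) ring_scheme \<Rightarrow> ('a, 'b, 'd) lie_algebra_scheme \<Rightarrow> nat \<Rightarrow> 'b set" where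
  "derived_series F L 0 = carrier L"
| "derived_series F L (Suc k) = lie_product F L (derived_series F L k) (derived_series F L k)"

definition lie_nilpotent ::
    "('a, 'c) ring_scheme \<Rightarrow> ('a, 'b, 'd) lie_algebra_scheme \<Rightarrow> bool" where
  "lie_nilpotent F L \<longleftrightarrow> (\<exists>k. lower_central_series F L k = {\<zero>\<^bsub>L\<^esub>})"

definition lie_solvable ::
    "('a, 'c) ring_scheme \<Rightarrow> ('a, 'b, 'd) lie_algebra_scheme \<Rightarrow> bool" where
  "lie_solvable F L \<longleftrightarrow> (\<exists>k. derived_series F L k = {\<zero>\<^bsub>L\<^esub>})"


section \<open>Nilradical, upper nilpotent series, nilpotent length\<close>

text \<open>
  The nilradical is the sum of all nilpotent ideals; if \<open>L\<close> is finite-dimensional this is the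
  largest nilpotent ideal of \<open>L\<close>.
\<close>

definition nilradical ::
    "('a, 'c) ring_scheme \<Rightarrow> ('a, 'b, 'd) lie_algebra_scheme \<Rightarrow> 'b set" where
  "nilradical F L =
     subspace_span F L (\<Union>{I. lie_ideal F L I \<and> lie_nilpotent F (lie_restrict L I)})"

text \<open>\<open>N\<^sub>i\<^sub>+\<^sub>1\<close> is the full preimage in \<open>L\<close> of the nilradical of \<open>L / N\<^sub>i\<close>.\<close>

primrec upper_nilpotent_series ::
    "('a, 'c) ring_scheme \<Rightarrow> ('a, 'b, 'd) lie_algebra_scheme \<Rightarrow> nat \<Rightarrow> 'b set" where
  "upper_nilpotent_series F L 0 = {\<zero>\<^bsub>L\<^esub>}"
| "upper_nilpotent_series F L (Suc i) =
     {x \<in> carrier L. upper_nilpotent_series F L i +>\<^bsub>L\<^esub> x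
        \<in> nilradical F (lie_quotient L (upper_nilpotent_series F L i))}"

definition nilpotent_length ::
    "('a, 'c) ring_scheme \<Rightarrow> ('a, 'b, 'd) lie_algebra_scheme \<Rightarrow> nat" where
  "nilpotent_length F L = (LEAST m. upper_nilpotent_series F L m = carrier L)"

definition nilpotent_length_class ::
    "('a, 'c) ring_scheme \<Rightarrow> nat \<Rightarrow> ('a, 'b, 'd) lie_algebra_scheme set" where
  "nilpotent_length_class F n =
     {L. lie_algebra F L \<and> finite_dimensional F L \<and> lie_solvable F L \<and>
         (\<exists>m. upper_nilpotent_series F L m = carrier L) \<and> nilpotent_length F L = n}"


section \<open>Frattini subalgebra and Frattini series\<close>

definition maximal_lie_subalgebra ::
    "('a, 'c) ring_scheme \<Rightarrow> ('a, 'b, 'd) lie_algebra_scheme \<Rightarrow> 'b set \<Rightarrow> bool" where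
  "maximal_lie_subalgebra F L M \<longleftrightarrow>
     lie_subalgebra F L M \<and> M \<noteq> carrier L \<and>
     (\<forall>K. lie_subalgebra F L K \<and> M \<subseteq> K \<longrightarrow> K = M \<or> K = carrier L)"

text \<open>
  Intersecting with the carrier only matters when there is no maximal subalgebra, which for
  finite-dimensional \<open>L\<close> means \<open>L = 0\<close>; thus the Frattini subalgebra of \<open>0\<close> is \<open>0\<close>.
\<close>

definition frattini ::
    "('a, 'c) ring_scheme \<Rightarrow> ('a, 'b, 'd) lie_algebra_scheme \<Rightarrow> 'b set" where
  "frattini F L = carrier L \<inter> \<Inter>{M. maximal_lie_subalgebra F L M}"

text \<open>
  \<open>\<phi>\<^sub>i\<close> is the full preimage in \<open>L\<close> of the Frattini subalgebra of \<open>L / N\<^sub>i\<^sub>-\<^sub>1\<close>.  It is meant for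
  \<open>i \<ge> 1\<close> only.
\<close>

definition frattini_series ::
    "('a, 'c) ring_scheme \<Rightarrow> ('a, 'b, 'd) lie_algebra_scheme \<Rightarrow> nat \<Rightarrow> 'b set" where
  "frattini_series F L i =
     {x \<in> carrier L. upper_nilpotent_series F L (i - 1) +>\<^bsub>L\<^esub> x
        \<in> frattini F (lie_quotient L (upper_nilpotent_series F L (i - 1)))}"

end

theory Submission
  imports Defs
begin

text \<open>
  Put \<open>U\<^sub>0 = L\<close> and let \<open>U\<^sub>i\<close> be a minimal subalgebra of \<open>U\<^sub>i\<^sub>-\<^sub>1\<close> supplementing the ideal
  \<open>B\<^sub>i = N\<^sub>i(L) \<inter> U\<^sub>i\<^sub>-\<^sub>1\<close>.  Minimality gives \<open>L = N\<^sub>i(L) + U\<^sub>i\<close> and \<open>N\<^sub>i(L) \<inter> U\<^sub>i \<subseteq> \<phi>(U\<^sub>i)\<close>, so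
  the maximal subalgebras of \<open>U\<^sub>i\<close> are the traces of the maximal subalgebras of \<open>L\<close> above \<open>N\<^sub>i(L)\<close>;
  this is (iv).  Elements of \<open>B\<^sub>i\<^sub>+\<^sub>1\<close> act nilpotently on \<open>U\<^sub>i\<close> modulo \<open>\<phi>(U\<^sub>i)\<close>, hence, by Fitting's
  lemma and the non-generator property of \<open>\<phi>(U\<^sub>i)\<close>, nilpotently on \<open>U\<^sub>i\<close>, and \<open>B\<^sub>i\<^sub>+\<^sub>1\<close> is nilpotent by
  Engel's theorem.  Conversely, \<open>N\<^sub>n\<^sub>-\<^sub>1(L) = L\<close> would give \<open>B\<^sub>n = \<phi>(B\<^sub>n)\<close>, impossible for \<open>B\<^sub>n \<noteq> 0\<close>.
\<close>

section \<open>Submodules and finite length\<close>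

text \<open>The supplement U_i is sought inside U_{i-1} rather than in L, so the chain decreases.
  This gives (iii): [B_i, B_j] lies in N_i because N_i is an ideal, and in U_{i-1} because B_j is
  contained in U_{j-1}, hence in U_{i-1}. The splittings U_{i-1} = B_i + U_i telescope down to
  U_{n-1} = B_n, which holds since N_n = L. Condition (iv) compares maximal subalgebras of U_i with
  those of L/N_i. Both are read off from subalgebras of L, so no isomorphism between U_i/(N_i
  \<inter> U_i) and L/N_i is built. Nilpotency has to be moved between L, its subalgebras and its
  quotients. Two choices make this cheap: a rank function on submodules instead of a dimension,
  since it restricts to subalgebras and pulls back along quotient maps; and the series L, [A, L],
  [A, [A, L]], ... in the ambient algebra instead of the lower central series of A, since it can be
  controlled for sums. In the nilpotency argument phi(U_i) enters only as a set of
  non-generators.\<close>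

context module
begin

text \<open>Closure under negation is absent from the right-hand side because -x = (-1) x, which
  shortens all later membership checks.\<close>

lemma submodule_iff:
  "submodule H R M \<longleftrightarrow> H \<subseteq> carrier M \<and> \<zero>\<^bsub>M\<^esub> \<in> H \<and>
     (\<forall>x\<in>H. \<forall>y\<in>H. x \<oplus>\<^bsub>M\<^esub> y \<in> H) \<and> (\<forall>a\<in>carrier R. \<forall>x\<in>H. a \<odot>\<^bsub>M\<^esub> x \<in> H)"
proof
  assume H: "submodule H R M"
  then have "\<zero>\<^bsub>M\<^esub> \<in> H"
    using submodule.axioms(1) subgroup.one_closed by fastforce
  then show "H \<subseteq> carrier M \<and> \<zero>\<^bsub>M\<^esub> \<in> H \<and>
     (\<forall>x\<in>H. \<forall>y\<in>H. x \<oplus>\<^bsub>M\<^esub> y \<in> H) \<and> (\<forall>a\<in>carrier R. \<forall>x\<in>H. a \<odot>\<^bsub>M\<^esub> x \<in> H)"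
    using submoduleE[OF H] by blast
next
  assume H: "H \<subseteq> carrier M \<and> \<zero>\<^bsub>M\<^esub> \<in> H \<and>
     (\<forall>x\<in>H. \<forall>y\<in>H. x \<oplus>\<^bsub>M\<^esub> y \<in> H) \<and> (\<forall>a\<in>carrier R. \<forall>x\<in>H. a \<odot>\<^bsub>M\<^esub> x \<in> H)"
  have "\<ominus>\<^bsub>M\<^esub> x \<in> H" if "x \<in> H" for x
  proof -
    have "x \<in> carrier M" using that H by blast
    then have "\<ominus>\<^bsub>M\<^esub> x = (\<ominus> \<one>) \<odot>\<^bsub>M\<^esub> x"
      using smult_l_minus[of \<one> x] by simp
    then show ?thesis using H that by simp
  qed
  then show "submodule H R M"
    using H by (intro submoduleI) auto
qed

lemma submodule_imp:
  assumes "submodule H R M"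
  shows "H \<subseteq> carrier M" "\<zero>\<^bsub>M\<^esub> \<in> H"
    "\<And>x y. x \<in> H \<Longrightarrow> y \<in> H \<Longrightarrow> x \<oplus>\<^bsub>M\<^esub> y \<in> H"
    "\<And>a x. a \<in> carrier R \<Longrightarrow> x \<in> H \<Longrightarrow> a \<odot>\<^bsub>M\<^esub> x \<in> H"
    "\<And>x. x \<in> H \<Longrightarrow> x \<in> carrier M"
    "\<And>x. x \<in> H \<Longrightarrow> \<ominus>\<^bsub>M\<^esub> x \<in> H"
    "\<And>x y. x \<in> H \<Longrightarrow> y \<in> H \<Longrightarrow> x \<ominus>\<^bsub>M\<^esub> y \<in> H"
  using assms submoduleE[OF assms] unfolding submodule_iff a_minus_def by blast+

lemma submodule_Int:
  "submodule H R M \<Longrightarrow> submodule K R M \<Longrightarrow> submodule (H \<inter> K) R M"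
  unfolding submodule_iff by blast

lemma submodule_zero: "submodule {\<zero>\<^bsub>M\<^esub>} R M"
  unfolding submodule_iff by simp

lemma mem_set_add: "x \<in> H <+>\<^bsub>M\<^esub> K \<longleftrightarrow> (\<exists>h\<in>H. \<exists>k\<in>K. x = h \<oplus>\<^bsub>M\<^esub> k)"
  unfolding set_add_def' by blast

lemma submodule_set_add:
  assumes H: "submodule H R M" and K: "submodule K R M"
  shows "submodule (H <+>\<^bsub>M\<^esub> K) R M"
proof -
  note HK [simp] = submodule_imp[OF H] submodule_imp[OF K]
  have "x \<oplus>\<^bsub>M\<^esub> y \<in> H <+>\<^bsub>M\<^esub> K" if "x \<in> H <+>\<^bsub>M\<^esub> K" "y \<in> H <+>\<^bsub>M\<^esub> K" for x y
  proof -
    from that obtain h k h' k' where "h \<in> H" "k \<in> K" "h' \<in> H" "k' \<in> K"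
      and "x = h \<oplus>\<^bsub>M\<^esub> k" "y = h' \<oplus>\<^bsub>M\<^esub> k'" unfolding mem_set_add by blast
    moreover from this have "x \<oplus>\<^bsub>M\<^esub> y = (h \<oplus>\<^bsub>M\<^esub> h') \<oplus>\<^bsub>M\<^esub> (k \<oplus>\<^bsub>M\<^esub> k')"
      by (simp add: M.a_ac)
    ultimately show ?thesis unfolding mem_set_add using HK(3,10) by blast
  qed
  moreover have "a \<odot>\<^bsub>M\<^esub> x \<in> H <+>\<^bsub>M\<^esub> K" if "a \<in> carrier R" "x \<in> H <+>\<^bsub>M\<^esub> K" for a x
  proof -
    from that obtain h k where "h \<in> H" "k \<in> K" "x = h \<oplus>\<^bsub>M\<^esub> k"
      unfolding mem_set_add by blast
    then have "a \<odot>\<^bsub>M\<^esub> x = a \<odot>\<^bsub>M\<^esub> h \<oplus>\<^bsub>M\<^esub> a \<odot>\<^bsub>M\<^esub> k"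
      using that by (simp add: smult_r_distr)
    then show ?thesis unfolding mem_set_add
      using HK(4,11) that \<open>h \<in> H\<close> \<open>k \<in> K\<close> by blast
  qed
  moreover have "\<zero>\<^bsub>M\<^esub> \<in> H <+>\<^bsub>M\<^esub> K"
    unfolding mem_set_add using HK(2,9) M.r_zero by (metis M.zero_closed)
  moreover have "H <+>\<^bsub>M\<^esub> K \<subseteq> carrier M"
    by (auto simp: mem_set_add)
  ultimately show ?thesis unfolding submodule_iff by blast
qed

lemma submodule_line:
  assumes "s \<in> carrier M"
  shows "submodule ((\<lambda>a. a \<odot>\<^bsub>M\<^esub> s) ` carrier R) R M"
proof -
  have "a \<odot>\<^bsub>M\<^esub> s \<oplus>\<^bsub>M\<^esub> b \<odot>\<^bsub>M\<^esub> s = (a \<oplus> b) \<odot>\<^bsub>M\<^esub> s"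
    "a \<odot>\<^bsub>M\<^esub> (b \<odot>\<^bsub>M\<^esub> s) = (a \<otimes> b) \<odot>\<^bsub>M\<^esub> s"
    if "a \<in> carrier R" "b \<in> carrier R" for a b
    using that assms by (simp_all add: smult_l_distr smult_assoc1)
  moreover have "\<zero>\<^bsub>M\<^esub> \<in> (\<lambda>a. a \<odot>\<^bsub>M\<^esub> s) ` carrier R"
    using assms by (intro image_eqI[of _ _ \<zero>]) auto
  ultimately show ?thesis
    unfolding submodule_iff using assms by auto
qed

lemma subset_set_add:
  assumes "submodule H R M" "submodule K R M"
  shows "H \<subseteq> H <+>\<^bsub>M\<^esub> K" "K \<subseteq> H <+>\<^bsub>M\<^esub> K"
  unfolding subset_eq mem_set_add
  using submodule_imp[OF assms(1)] submodule_imp[OF assms(2)]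
  by (metis M.r_zero, metis M.l_zero)

lemma set_add_least:
  "submodule V R M \<Longrightarrow> H \<subseteq> V \<Longrightarrow> K \<subseteq> V \<Longrightarrow> H <+>\<^bsub>M\<^esub> K \<subseteq> V"
  by (auto simp: mem_set_add subset_eq intro!: submodule_imp(3))

lemma set_add_mono: "H \<subseteq> H' \<Longrightarrow> K \<subseteq> K' \<Longrightarrow> H <+>\<^bsub>M\<^esub> K \<subseteq> H' <+>\<^bsub>M\<^esub> K'"
  by (auto simp: mem_set_add subset_iff; blast)

lemma set_add_commute:
  assumes "H \<subseteq> carrier M" "K \<subseteq> carrier M"
  shows "H <+>\<^bsub>M\<^esub> K = K <+>\<^bsub>M\<^esub> H"
  using assms by (auto simp: mem_set_add subset_eq intro: M.a_comm) (metis M.a_comm)+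

text \<open>In x = h + k with x in V, the part k lies in V already, hence so does h = x - k. This
  modular law later splits N_{i+1} along L = N_i + U and matches subalgebras of U with subalgebras
  of L above N_i.\<close>

lemma Dedekind_law:
  assumes H: "submodule H R M" and K: "submodule K R M" and V: "submodule V R M"
    and "K \<subseteq> V"
  shows "V \<inter> (H <+>\<^bsub>M\<^esub> K) = (V \<inter> H) <+>\<^bsub>M\<^esub> K"
proof
  show "(V \<inter> H) <+>\<^bsub>M\<^esub> K \<subseteq> V \<inter> (H <+>\<^bsub>M\<^esub> K)"
    using set_add_least[OF V _ \<open>K \<subseteq> V\<close>] set_add_mono[of "V \<inter> H" H K K] by blast
next
  show "V \<inter> (H <+>\<^bsub>M\<^esub> K) \<subseteq> (V \<inter> H) <+>\<^bsub>M\<^esub> K"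
  proof
    fix x assume "x \<in> V \<inter> (H <+>\<^bsub>M\<^esub> K)"
    then obtain h k where *: "x \<in> V" "h \<in> H" "k \<in> K" "x = h \<oplus>\<^bsub>M\<^esub> k"
      by (auto simp: mem_set_add)
    then have "h = x \<ominus>\<^bsub>M\<^esub> k"
      using submodule_imp(5)[OF H] submodule_imp(5)[OF K]
      by (simp add: a_minus_def M.a_assoc M.r_neg)
    then have "h \<in> V" using * submodule_imp(7)[OF V] \<open>K \<subseteq> V\<close> by blast
    then show "x \<in> (V \<inter> H) <+>\<^bsub>M\<^esub> K" using * unfolding mem_set_add by blast
  qed
qed

lemma submodule_span: "S \<subseteq> carrier M \<Longrightarrow> submodule (subspace_span R M S) R M"
  using carrier_is_submodule submodule_imp(1)
  unfolding subspace_span_def submodule_iff[of "\<Inter> _"]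
  by (auto intro: submodule_imp)

lemma subset_span: "S \<subseteq> subspace_span R M S"
  unfolding subspace_span_def by blast

lemma span_least: "submodule H R M \<Longrightarrow> S \<subseteq> H \<Longrightarrow> subspace_span R M S \<subseteq> H"
  unfolding subspace_span_def by blast

lemma submodule_restrict_iff:
  assumes "submodule U R M"
  shows "submodule H R (M\<lparr>carrier := U\<rparr>) \<longleftrightarrow> submodule H R M \<and> H \<subseteq> U"
  using module.submodule_iff[OF submodule.submodule_is_module[OF assms module_axioms]]
    submodule_iff submodule_imp(1)[OF assms] by auto

text \<open>The span taken in M already lies in U, so shrinking the carrier removes competing
  submodules but not the smallest one.\<close>

lemma span_restrict:
  assumes "submodule U R M" "S \<subseteq> U"
  shows "subspace_span R (M\<lparr>carrier := U\<rparr>) S = subspace_span R M S"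
proof -
  have "subspace_span R M S \<subseteq> U" using assms by (rule span_least)
  moreover have "submodule (subspace_span R M S) R M"
    using submodule_span assms submodule_imp(1) by blast
  ultimately show ?thesis
    using subset_span[of S]
    unfolding subspace_span_def submodule_restrict_iff[OF assms(1)] by blast
qed

lemma subspace_sum_empty: "subspace_sum M {} B = {\<zero>\<^bsub>M\<^esub>}"
  unfolding subspace_sum_def by simp

text \<open>Replaces choice functions by a binary sum. This serves both recursions: sums over {1..i}
  grow at the top, sums over {i+1..n} at the bottom.\<close>

lemma subspace_sum_insert:
  assumes "finite J" "i \<notin> J" "\<And>j. j \<in> insert i J \<Longrightarrow> B j \<subseteq> carrier M"
  shows "subspace_sum M (insert i J) B = B i <+>\<^bsub>M\<^esub> subspace_sum M J B"
proof -
  have ins: "(\<Oplus>\<^bsub>M\<^esub>j\<in>insert i J. b j) = b i \<oplus>\<^bsub>M\<^esub> (\<Oplus>\<^bsub>M\<^esub>j\<in>J. b j)"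
    if "b \<in> (\<Pi> j\<in>insert i J. B j)" for b
    using that assms by (intro M.finsum_insert) (auto simp: Pi_iff)
  show ?thesis
  proof (intro equalityI subsetI)
    fix x assume "x \<in> subspace_sum M (insert i J) B"
    then obtain b where "b \<in> (\<Pi> j\<in>insert i J. B j)" "x = (\<Oplus>\<^bsub>M\<^esub>j\<in>insert i J. b j)"
      unfolding subspace_sum_def by blast
    then show "x \<in> B i <+>\<^bsub>M\<^esub> subspace_sum M J B"
      using ins unfolding mem_set_add subspace_sum_def by (auto simp: Pi_iff)
  next
    fix x assume "x \<in> B i <+>\<^bsub>M\<^esub> subspace_sum M J B"
    then obtain c b where cb: "c \<in> B i" "b \<in> (\<Pi> j\<in>J. B j)" "x = c \<oplus>\<^bsub>M\<^esub> (\<Oplus>\<^bsub>M\<^esub>j\<in>J. b j)"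
      unfolding mem_set_add subspace_sum_def by blast
    define b' where "b' = b(i := c)"
    have b': "b' \<in> (\<Pi> j\<in>insert i J. B j)" using cb b'_def by (auto simp: Pi_iff)
    have "(\<Oplus>\<^bsub>M\<^esub>j\<in>J. b j) = (\<Oplus>\<^bsub>M\<^esub>j\<in>J. b' j)"
      using cb assms b'_def by (intro M.finsum_cong') (auto simp: Pi_iff)
    then have "x = (\<Oplus>\<^bsub>M\<^esub>j\<in>insert i J. b' j)"
      using ins[OF b'] cb b'_def by simp
    then show "x \<in> subspace_sum M (insert i J) B"
      using b' unfolding subspace_sum_def by blast
  qed
qed

lemma subspace_sum_subset:
  assumes "finite J" "\<And>j. j \<in> J \<Longrightarrow> B j \<subseteq> carrier M"
  shows "subspace_sum M J B \<subseteq> carrier M"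
  using assms unfolding subspace_sum_def by (auto intro!: M.finsum_closed)

lemma subspace_sum_singleton:
  assumes "B i \<subseteq> carrier M"
  shows "subspace_sum M {i} B = B i"
  using assms subspace_sum_insert[of "{}" i B] subspace_sum_empty[of B]
  by (force simp: set_eq_iff mem_set_add)

lemma subspace_sum_atMost_Suc:
  assumes "\<And>j. j \<in> {1..Suc i} \<Longrightarrow> B j \<subseteq> carrier M"
  shows "subspace_sum M {1..Suc i} B = subspace_sum M {1..i} B <+>\<^bsub>M\<^esub> B (Suc i)"
proof -
  have "subspace_sum M {1..Suc i} B = B (Suc i) <+>\<^bsub>M\<^esub> subspace_sum M {1..i} B"
    using subspace_sum_insert[of "{1..i}" "Suc i" B] assms
    by (simp add: atLeastAtMostSuc_conv)
  then show ?thesis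
    using set_add_commute subspace_sum_subset[of "{1..i}" B] assms by simp
qed

end

text \<open>Any strictly monotone rank with values in nat will do; it is not tied to the dimension.
  It can therefore be restricted to submodules or composed with preimages without constructing
  bases.\<close>

definition finite_length ::
    "('a, 'c) ring_scheme \<Rightarrow> ('a, 'b, 'd) module_scheme \<Rightarrow> bool" where
  "finite_length F V \<longleftrightarrow> (\<exists>rk :: 'b set \<Rightarrow> nat. \<forall>H K.
     submodule H F V \<and> submodule K F V \<and> H \<subset> K \<longrightarrow> rk H < rk K)"

text \<open>Ranks are bounded by that of the whole module, so a member of largest rank exists, and a
  proper enlargement of it would have larger rank.\<close>

lemma (in module) finite_length_maximal:
  assumes "finite_length R M" "P H0" "\<And>H. P H \<Longrightarrow> submodule H R M"
  obtains H where "P H" "\<And>K. P K \<Longrightarrow> H \<subseteq> K \<Longrightarrow> K = H"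
proof -
  obtain rk :: "_ \<Rightarrow> nat" where
    rk: "\<And>H K. submodule H R M \<Longrightarrow> submodule K R M \<Longrightarrow> H \<subset> K \<Longrightarrow> rk H < rk K"
    using assms(1) unfolding finite_length_def by blast
  have "rk H \<le> rk (carrier M)" if "P H" for H
    using rk[OF assms(3)[OF that] carrier_is_submodule] submodule_imp(1)[OF assms(3)[OF that]]
    by (cases "H = carrier M") (auto simp: psubset_eq)
  then have "\<exists>H. P H \<and> (\<forall>K. P K \<longrightarrow> rk K \<le> rk H)"
    by (intro ex_has_greatest_nat[of P H0 rk "Suc (rk (carrier M))", OF assms(2)])
      (auto simp: less_Suc_eq_le)
  then obtain H where H: "P H" "\<And>K. P K \<Longrightarrow> rk K \<le> rk H" by auto
  have "K = H" if "P K" "H \<subseteq> K" for K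
  proof (rule ccontr)
    assume "K \<noteq> H"
    then have "rk H < rk K" using rk[of H K] assms(3) H(1) that by blast
    then show False using H(2)[OF that(1)] by simp
  qed
  then show ?thesis using that H(1) by blast
qed

lemma (in module) finite_length_minimal:
  assumes "finite_length R M" "P H0" "\<And>H. P H \<Longrightarrow> submodule H R M"
  obtains H where "P H" "\<And>K. P K \<Longrightarrow> K \<subseteq> H \<Longrightarrow> K = H"
proof -
  obtain rk :: "_ \<Rightarrow> nat" where
    rk: "\<And>H K. submodule H R M \<Longrightarrow> submodule K R M \<Longrightarrow> H \<subset> K \<Longrightarrow> rk H < rk K"
    using assms(1) unfolding finite_length_def by blast
  obtain H where H: "P H" "\<And>K. P K \<Longrightarrow> rk H \<le> rk K"
    using ex_has_least_nat[of P H0 rk] assms(2) by blast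
  have "K = H" if "P K" "K \<subseteq> H" for K
  proof (rule ccontr)
    assume "K \<noteq> H"
    then have "rk K < rk H" using rk[of K H] assms(3) H(1) that by blast
    then show False using H(2)[OF that(1)] by simp
  qed
  then show ?thesis using that H(1) by blast
qed

lemma (in module) finite_length_restrict:
  assumes "finite_length R M" "submodule U R M"
  shows "finite_length R (M\<lparr>carrier := U\<rparr>)"
proof -
  obtain rk :: "_ \<Rightarrow> nat" where
    "\<And>H K. submodule H R M \<Longrightarrow> submodule K R M \<Longrightarrow> H \<subset> K \<Longrightarrow> rk H < rk K"
    using assms(1) unfolding finite_length_def by blast
  then show ?thesis
    unfolding finite_length_def submodule_restrict_iff[OF assms(2)]
    by (intro exI[of _ rk]) simp
qed

text \<open>A submodule of \<open>V + F s\<close> is counted by its trace on \<open>V\<close>, plus one if it leaves \<open>V\<close>.\<close>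

lemma (in module) rank_extend:
  fixes rk :: "'c set \<Rightarrow> nat"
  assumes "field R" "submodule V R M" "s \<in> carrier M"
    and rk: "\<And>H K. submodule H R M \<Longrightarrow> submodule K R M \<Longrightarrow> H \<subset> K \<Longrightarrow> K \<subseteq> V \<Longrightarrow> rk H < rk K"
    and W: "\<And>w. w \<in> W \<Longrightarrow> \<exists>a\<in>carrier R. \<exists>v\<in>V. w = a \<odot>\<^bsub>M\<^esub> s \<oplus>\<^bsub>M\<^esub> v"
    and H: "submodule H R M" and K: "submodule K R M" and "H \<subset> K" "K \<subseteq> W"
  shows "rk (H \<inter> V) + (if H \<subseteq> V then 0 else 1) < rk (K \<inter> V) + (if K \<subseteq> V then 0 else 1)"
proof (cases "H \<inter> V = K \<inter> V")
  case False
  then have "rk (H \<inter> V) < rk (K \<inter> V)"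
    using rk[of "H \<inter> V" "K \<inter> V"] submodule_Int H K assms(2) \<open>H \<subset> K\<close> by blast
  then show ?thesis using \<open>H \<subset> K\<close> by auto
next
  case True
  \<comment> \<open>If H left V, it would contain some h = a s + v with a \<noteq> 0. Every element
    of K could then be reduced by a multiple of h to an element of K \<inter> V = H \<inter> V,
    which forces K into H.\<close>
  have "H \<subseteq> V"
  proof (rule ccontr)
    assume "\<not> H \<subseteq> V"
    then obtain h where h: "h \<in> H" "h \<notin> V" by blast
    then obtain a v where av: "a \<in> carrier R" "v \<in> V" "h = a \<odot>\<^bsub>M\<^esub> s \<oplus>\<^bsub>M\<^esub> v"
      using W \<open>H \<subset> K\<close> \<open>K \<subseteq> W\<close> by blast
    note V [simp] = submodule_imp[OF assms(2)]
    have "a \<noteq> \<zero>" using h av assms(3) by auto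
    then have a: "a \<in> Units R" using av assms(1) field.field_Units by blast
    have "K \<subseteq> H"
    proof
      fix x assume x: "x \<in> K"
      then obtain b w where bw: "b \<in> carrier R" "w \<in> V" "x = b \<odot>\<^bsub>M\<^esub> s \<oplus>\<^bsub>M\<^esub> w"
        using W \<open>K \<subseteq> W\<close> by blast
      \<comment> \<open>With this scalar c h and x have the same coefficient at s, so x - c h lies
        in V.\<close>
      define c where "c = b \<otimes> inv a"
      have c: "c \<in> carrier R" "c \<otimes> a = b"
        using a av bw by (auto simp: c_def R.m_assoc)
      have ch: "c \<odot>\<^bsub>M\<^esub> h \<in> H" using submodule_imp[OF H] c h by blast
      have hc: "h \<in> carrier M" "x \<in> carrier M"
        using submodule_imp(5)[OF H] submodule_imp(5)[OF K] h x by auto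
      have "c \<odot>\<^bsub>M\<^esub> h = b \<odot>\<^bsub>M\<^esub> s \<oplus>\<^bsub>M\<^esub> c \<odot>\<^bsub>M\<^esub> v"
        using av c assms(3) by (simp add: smult_r_distr smult_assoc1[symmetric])
      then have "x = c \<odot>\<^bsub>M\<^esub> h \<oplus>\<^bsub>M\<^esub> (w \<ominus>\<^bsub>M\<^esub> c \<odot>\<^bsub>M\<^esub> v)"
        using bw av c assms(3) by (simp add: a_minus_def M.a_ac M.r_neg M.r_neg1 M.r_neg2)
      moreover have wV: "w \<ominus>\<^bsub>M\<^esub> c \<odot>\<^bsub>M\<^esub> v \<in> V" using bw av c by simp
      moreover have "w \<ominus>\<^bsub>M\<^esub> c \<odot>\<^bsub>M\<^esub> v = x \<ominus>\<^bsub>M\<^esub> c \<odot>\<^bsub>M\<^esub> h"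
        using calculation(1) wV c hc V(5)
        by (simp add: a_minus_def M.a_ac M.r_neg1 M.r_neg2)
      ultimately have "w \<ominus>\<^bsub>M\<^esub> c \<odot>\<^bsub>M\<^esub> v \<in> K \<inter> V"
        using submodule_imp(7)[OF K] x ch \<open>H \<subset> K\<close> by auto
      then have "w \<ominus>\<^bsub>M\<^esub> c \<odot>\<^bsub>M\<^esub> v \<in> H" using True by blast
      then show "x \<in> H"
        using \<open>x = c \<odot>\<^bsub>M\<^esub> h \<oplus>\<^bsub>M\<^esub> (w \<ominus>\<^bsub>M\<^esub> c \<odot>\<^bsub>M\<^esub> v)\<close> ch submodule_imp(3)[OF H] by metis
    qed
    then show False using \<open>H \<subset> K\<close> by blast
  qed
  moreover from this have "\<not> K \<subseteq> V" using True \<open>H \<subset> K\<close> by blast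
  ultimately show ?thesis using True by simp
qed

text \<open>Induction over a spanning set, with one unit of rank per generator. Linear independence
  plays no part: if s already lies in the span V of the previous generators, no submodule under
  consideration leaves V and the extra unit is never added.\<close>

lemma (in module) finite_dimensional_finite_length:
  assumes "field R" "finite_dimensional R M"
  shows "finite_length R M"
proof -
  let ?comb = "\<lambda>T. {(\<Oplus>\<^bsub>M\<^esub>s\<in>T. a s \<odot>\<^bsub>M\<^esub> s) | a. a \<in> T \<rightarrow> carrier R}"
  obtain S where S: "finite S" "S \<subseteq> carrier M" "carrier M = ?comb S"
    using assms(2) unfolding finite_dimensional_def by blast
  \<comment> \<open>The rank is only asked to be strict below the span of T, which is what makes it
    extendable by one generator at a time; that the span is a submodule is carried along for the
    same step.\<close>
  have "submodule (?comb T) R M \<and> (\<exists>rk :: 'c set \<Rightarrow> nat. \<forall>H K.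
      submodule H R M \<longrightarrow> submodule K R M \<longrightarrow> H \<subset> K \<longrightarrow> K \<subseteq> ?comb T \<longrightarrow> rk H < rk K)"
    if "finite T" "T \<subseteq> carrier M" for T
    using that
  proof (induction T)
    case empty
    have "H \<subset> K \<Longrightarrow> K \<subseteq> {\<zero>\<^bsub>M\<^esub>} \<Longrightarrow> submodule H R M \<Longrightarrow> False" for H K
      using submodule_imp(2)[of H] by blast
    then have "\<forall>H K. submodule H R M \<longrightarrow> submodule K R M \<longrightarrow> H \<subset> K \<longrightarrow> K \<subseteq> {\<zero>\<^bsub>M\<^esub>} \<longrightarrow> (0::nat) < 0"
      by blast
    then show ?case using submodule_zero by (auto intro!: exI[of _ "\<lambda>_. 0"])
  next
    case (insert s T)
    let ?V = "?comb T"
    have line: "(\<lambda>a. a \<odot>\<^bsub>M\<^esub> s) ` carrier R <+>\<^bsub>M\<^esub> ?V = ?comb (insert s T)"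
    proof -
      have ins: "(\<Oplus>\<^bsub>M\<^esub>j\<in>insert s T. a j \<odot>\<^bsub>M\<^esub> j) = a s \<odot>\<^bsub>M\<^esub> s \<oplus>\<^bsub>M\<^esub> (\<Oplus>\<^bsub>M\<^esub>j\<in>T. a j \<odot>\<^bsub>M\<^esub> j)"
        if "a \<in> insert s T \<rightarrow> carrier R" for a
        using that insert by (intro M.finsum_insert) (auto simp: Pi_iff)
      show ?thesis
      proof (intro equalityI subsetI)
        fix x assume "x \<in> (\<lambda>a. a \<odot>\<^bsub>M\<^esub> s) ` carrier R <+>\<^bsub>M\<^esub> ?V"
        then obtain c b where cb: "c \<in> carrier R" "b \<in> T \<rightarrow> carrier R"
          "x = c \<odot>\<^bsub>M\<^esub> s \<oplus>\<^bsub>M\<^esub> (\<Oplus>\<^bsub>M\<^esub>j\<in>T. b j \<odot>\<^bsub>M\<^esub> j)"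
          unfolding mem_set_add by blast
        define b' where "b' = b(s := c)"
        have b': "b' \<in> insert s T \<rightarrow> carrier R" using cb b'_def by (auto simp: Pi_iff)
        have "(\<Oplus>\<^bsub>M\<^esub>j\<in>T. b j \<odot>\<^bsub>M\<^esub> j) = (\<Oplus>\<^bsub>M\<^esub>j\<in>T. b' j \<odot>\<^bsub>M\<^esub> j)"
          using cb insert b'_def by (intro M.finsum_cong') (auto simp: Pi_iff)
        then have "x = (\<Oplus>\<^bsub>M\<^esub>j\<in>insert s T. b' j \<odot>\<^bsub>M\<^esub> j)"
          using ins[OF b'] cb b'_def by simp
        then show "x \<in> ?comb (insert s T)" using b' by blast
      next
        fix x assume "x \<in> ?comb (insert s T)"
        then show "x \<in> (\<lambda>a. a \<odot>\<^bsub>M\<^esub> s) ` carrier R <+>\<^bsub>M\<^esub> ?V"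
          using ins unfolding mem_set_add by (fastforce simp: Pi_iff)
      qed
    qed
    have sub: "submodule ((\<lambda>a. a \<odot>\<^bsub>M\<^esub> s) ` carrier R) R M"
      using insert by (intro submodule_line) simp
    from insert have IH: "submodule ?V R M \<and> (\<exists>rk :: 'c set \<Rightarrow> nat. \<forall>H K.
        submodule H R M \<longrightarrow> submodule K R M \<longrightarrow> H \<subset> K \<longrightarrow> K \<subseteq> ?V \<longrightarrow> rk H < rk K)"
      by auto
    then have V: "submodule ?V R M" by (rule conjunct1)
    from IH obtain rk :: "'c set \<Rightarrow> nat" where
      "\<forall>H K. submodule H R M \<longrightarrow> submodule K R M \<longrightarrow> H \<subset> K \<longrightarrow> K \<subseteq> ?V \<longrightarrow> rk H < rk K"
      by (elim conjE exE)
    then have rk: "\<And>H K. submodule H R M \<Longrightarrow> submodule K R M \<Longrightarrow> H \<subset> K \<Longrightarrow> K \<subseteq> ?V \<Longrightarrow> rk H < rk K"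
      by (elim allE impE)
    have W: "\<exists>a\<in>carrier R. \<exists>v\<in>?V. w = a \<odot>\<^bsub>M\<^esub> s \<oplus>\<^bsub>M\<^esub> v" if "w \<in> ?comb (insert s T)" for w
      using that unfolding line[symmetric] mem_set_add by blast
    have s: "s \<in> carrier M" using insert by blast
    have "submodule (?comb (insert s T)) R M"
      using submodule_set_add[OF sub V] unfolding line .
    moreover have "\<forall>H K. submodule H R M \<longrightarrow> submodule K R M \<longrightarrow> H \<subset> K \<longrightarrow>
        K \<subseteq> ?comb (insert s T) \<longrightarrow> rk (H \<inter> ?V) + (if H \<subseteq> ?V then 0 else 1)
          < rk (K \<inter> ?V) + (if K \<subseteq> ?V then 0 else 1)"
      using rank_extend[OF assms(1) V s, where rk = rk and W = "?comb (insert s T)", OF rk W]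
      by (intro allI impI)
    ultimately show ?case
      by (intro conjI exI[of _ "\<lambda>H. rk (H \<inter> ?V) + (if H \<subseteq> ?V then 0 else 1)"])
  qed
  from this[OF S(1,2)] obtain rk :: "'c set \<Rightarrow> nat" where rk: "\<forall>H K. submodule H R M \<longrightarrow>
      submodule K R M \<longrightarrow> H \<subset> K \<longrightarrow> K \<subseteq> carrier M \<longrightarrow> rk H < rk K"
    unfolding S(3)[symmetric] by (elim conjE exE)
  show ?thesis
    unfolding finite_length_def
  proof (intro exI[of _ rk] allI impI, elim conjE)
    fix H K assume "submodule H R M" "submodule K R M" "H \<subset> K"
    then show "rk H < rk K"
      using rk[rule_format, of H K] submodule_imp(1)[of K] by simp
  qed
qed

section \<open>Engel's theorem and the nilradical\<close>

context lie_algebra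
begin

lemma lie_zero [simp]:
  assumes "x \<in> carrier L"
  shows "lie_bracket L \<zero>\<^bsub>L\<^esub> x = \<zero>\<^bsub>L\<^esub>" "lie_bracket L x \<zero>\<^bsub>L\<^esub> = \<zero>\<^bsub>L\<^esub>"
  using lie_smult_left[of \<zero> "\<zero>\<^bsub>L\<^esub>" x] lie_smult_right[of \<zero> x "\<zero>\<^bsub>L\<^esub>"] assms lie_closed
  by simp_all

lemma lie_minus:
  assumes "x \<in> carrier L" "y \<in> carrier L"
  shows "lie_bracket L x (\<ominus>\<^bsub>L\<^esub> y) = \<ominus>\<^bsub>L\<^esub> lie_bracket L x y"
proof (rule M.minus_equality[symmetric])
  show "lie_bracket L x (\<ominus>\<^bsub>L\<^esub> y) \<oplus>\<^bsub>L\<^esub> lie_bracket L x y = \<zero>\<^bsub>L\<^esub>"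
    using lie_add_right[of x "\<ominus>\<^bsub>L\<^esub> y" y] assms by (simp add: M.l_neg)
qed (use assms lie_closed in auto)

lemma lie_anticomm:
  assumes "x \<in> carrier L" "y \<in> carrier L"
  shows "lie_bracket L y x = \<ominus>\<^bsub>L\<^esub> lie_bracket L x y"
proof (rule M.minus_equality[symmetric])
  have "\<zero>\<^bsub>L\<^esub> = lie_bracket L (x \<oplus>\<^bsub>L\<^esub> y) (x \<oplus>\<^bsub>L\<^esub> y)"
    using assms lie_alternating by simp
  also have "\<dots> = lie_bracket L y x \<oplus>\<^bsub>L\<^esub> lie_bracket L x y"
    using assms by (simp add: lie_add_left lie_add_right lie_alternating[OF assms(1)] lie_alternating[OF assms(2)]
        lie_closed M.a_comm)
  finally show "lie_bracket L y x \<oplus>\<^bsub>L\<^esub> lie_bracket L x y = \<zero>\<^bsub>L\<^esub>" by (rule sym)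
qed (use assms lie_closed in auto)

text \<open>The Jacobi identity in the form that ad x is a derivation; it drives the stability of
  the action series and the computation with powers of ad x on brackets.\<close>

lemma lie_leibniz:
  assumes "x \<in> carrier L" "y \<in> carrier L" "z \<in> carrier L"
  shows "lie_bracket L x (lie_bracket L y z) =
    lie_bracket L (lie_bracket L x y) z \<oplus>\<^bsub>L\<^esub> lie_bracket L y (lie_bracket L x z)"
proof -
  have 1: "lie_bracket L z (lie_bracket L x y) = \<ominus>\<^bsub>L\<^esub> lie_bracket L (lie_bracket L x y) z"
    using assms lie_closed lie_anticomm[of "lie_bracket L x y" z] by simp
  have 2: "lie_bracket L y (lie_bracket L z x) = \<ominus>\<^bsub>L\<^esub> lie_bracket L y (lie_bracket L x z)"
    using assms lie_closed lie_anticomm[of x z] lie_minus[of y "lie_bracket L x z"] by simp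
  let ?a = "lie_bracket L x (lie_bracket L y z)"
  let ?b = "lie_bracket L y (lie_bracket L x z)"
  let ?c = "lie_bracket L (lie_bracket L x y) z"
  have car: "?a \<in> carrier L" "?b \<in> carrier L" "?c \<in> carrier L"
    using assms lie_closed by auto
  have "?a \<oplus>\<^bsub>L\<^esub> \<ominus>\<^bsub>L\<^esub> ?b \<oplus>\<^bsub>L\<^esub> \<ominus>\<^bsub>L\<^esub> ?c = \<zero>\<^bsub>L\<^esub>"
    using lie_jacobi[OF assms] unfolding 1 2 .
  then have "?a = \<ominus>\<^bsub>L\<^esub> (\<ominus>\<^bsub>L\<^esub> ?b \<oplus>\<^bsub>L\<^esub> \<ominus>\<^bsub>L\<^esub> ?c)"
    using car by (intro M.minus_equality[symmetric]) (auto simp: M.a_ac)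
  then show ?thesis
    using car by (simp add: M.minus_add M.a_comm)
qed

lemma lie_ideal_imp:
  assumes "lie_ideal F L I"
  shows "submodule I F L" "I \<subseteq> carrier L"
    "\<And>x y. x \<in> carrier L \<Longrightarrow> y \<in> I \<Longrightarrow> lie_bracket L x y \<in> I"
    "\<And>x y. x \<in> I \<Longrightarrow> y \<in> carrier L \<Longrightarrow> lie_bracket L x y \<in> I"
proof -
  show I: "submodule I F L" and l: "\<And>x y. x \<in> carrier L \<Longrightarrow> y \<in> I \<Longrightarrow> lie_bracket L x y \<in> I"
    using assms unfolding lie_ideal_def by auto
  show "I \<subseteq> carrier L" using submodule_imp(1)[OF I] .
  show "lie_bracket L x y \<in> I" if "x \<in> I" "y \<in> carrier L" for x y
    using lie_anticomm[of y x] l[of y x] submodule_imp(5,6)[OF I] that by simp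
qed

lemma lie_subalgebra_imp:
  assumes "lie_subalgebra F L U"
  shows "submodule U F L" "U \<subseteq> carrier L"
    "\<And>x y. x \<in> U \<Longrightarrow> y \<in> U \<Longrightarrow> lie_bracket L x y \<in> U"
  using assms submodule_imp(1) unfolding lie_subalgebra_def by auto

lemma lie_ideal_imp_subalgebra: "lie_ideal F L I \<Longrightarrow> lie_subalgebra F L I"
  using lie_ideal_imp[of I] unfolding lie_subalgebra_def by blast

lemma lie_subalgebra_carrier: "lie_subalgebra F L (carrier L)"
  unfolding lie_subalgebra_def using carrier_is_submodule lie_closed by auto

lemma lie_ideal_zero: "lie_ideal F L {\<zero>\<^bsub>L\<^esub>}"
  unfolding lie_ideal_def using submodule_zero by auto

lemma lie_subalgebra_Int:
  "lie_subalgebra F L U \<Longrightarrow> lie_subalgebra F L V \<Longrightarrow> lie_subalgebra F L (U \<inter> V)"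
  unfolding lie_subalgebra_def using submodule_Int by auto

text \<open>When [a + u, b + v] is expanded, every term except [u, v] has a factor in I.\<close>

lemma lie_subalgebra_ideal_add:
  assumes I: "lie_ideal F L I" and U: "lie_subalgebra F L U"
  shows "lie_subalgebra F L (I <+>\<^bsub>L\<^esub> U)"
proof -
  note I' = lie_ideal_imp[OF I] and U' = lie_subalgebra_imp[OF U]
  have "lie_bracket L x y \<in> I <+>\<^bsub>L\<^esub> U" if "x \<in> I <+>\<^bsub>L\<^esub> U" "y \<in> I <+>\<^bsub>L\<^esub> U" for x y
  proof -
    obtain a u b v where *: "a \<in> I" "u \<in> U" "x = a \<oplus>\<^bsub>L\<^esub> u" "b \<in> I" "v \<in> U" "y = b \<oplus>\<^bsub>L\<^esub> v"
      using \<open>x \<in> _\<close> \<open>y \<in> _\<close> by (auto simp: mem_set_add)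
    then have car: "a \<in> carrier L" "b \<in> carrier L" "u \<in> carrier L" "v \<in> carrier L"
      using I' U' by auto
    have "lie_bracket L x y = (lie_bracket L a (b \<oplus>\<^bsub>L\<^esub> v) \<oplus>\<^bsub>L\<^esub> lie_bracket L u b) \<oplus>\<^bsub>L\<^esub> lie_bracket L u v"
      using * car by (simp add: lie_add_left lie_add_right lie_closed M.a_ac)
    moreover have "lie_bracket L a (b \<oplus>\<^bsub>L\<^esub> v) \<oplus>\<^bsub>L\<^esub> lie_bracket L u b \<in> I"
      using * car I' submodule_imp(3)[OF I'(1)] by simp
    ultimately show ?thesis using U'(3)[OF \<open>u \<in> U\<close> \<open>v \<in> U\<close>] by (auto simp: mem_set_add)
  qed
  then show ?thesis
    unfolding lie_subalgebra_def using submodule_set_add[OF I'(1) U'(1)] by blast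
qed

lemma lie_ideal_add:
  assumes I: "lie_ideal F L I" and K: "lie_ideal F L K"
  shows "lie_ideal F L (I <+>\<^bsub>L\<^esub> K)"
proof -
  note I' = lie_ideal_imp[OF I] and K' = lie_ideal_imp[OF K]
  have "lie_bracket L x y \<in> I <+>\<^bsub>L\<^esub> K" if x: "x \<in> carrier L" and y: "y \<in> I <+>\<^bsub>L\<^esub> K" for x y
  proof -
    obtain a b where *: "a \<in> I" "b \<in> K" "y = a \<oplus>\<^bsub>L\<^esub> b"
      using y by (auto simp: mem_set_add)
    then have "lie_bracket L x y = lie_bracket L x a \<oplus>\<^bsub>L\<^esub> lie_bracket L x b"
      using I' K' x by (auto intro: lie_add_right)
    then show ?thesis using I'(3)[OF x] K'(3)[OF x] * by (auto simp: mem_set_add)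
  qed
  then show ?thesis
    unfolding lie_ideal_def using submodule_set_add[OF I'(1) K'(1)] by blast
qed

lemma lie_algebra_restrict:
  assumes U: "lie_subalgebra F L U"
  shows "lie_algebra F (lie_restrict L U)"
proof -
  note U' = lie_subalgebra_imp[OF U]
  have mem: "x \<in> carrier L" if "x \<in> U" for x using that U' by blast
  show ?thesis
    by (intro lie_algebra.intro lie_algebra_axioms.intro field_axioms
        submodule.submodule_is_module[OF U'(1) module_axioms])
      (simp_all add: mem U'(3) lie_add_left lie_add_right lie_smult_left lie_smult_right
        lie_alternating lie_jacobi)
qed

lemma lie_subalgebra_restrict_iff:
  assumes "lie_subalgebra F L U"
  shows "lie_subalgebra F (lie_restrict L U) H \<longleftrightarrow> lie_subalgebra F L H \<and> H \<subseteq> U"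
  unfolding lie_subalgebra_def submodule_restrict_iff[OF lie_subalgebra_imp(1)[OF assms]] by auto

lemma submodule_lie_product:
  assumes "A \<subseteq> carrier L" "B \<subseteq> carrier L"
  shows "submodule (lie_product F L A B) F L"
  unfolding lie_product_def using assms lie_closed
  by (intro submodule_span) (auto simp: subset_iff)

lemma lie_bracket_mem_product: "a \<in> A \<Longrightarrow> b \<in> B \<Longrightarrow> lie_bracket L a b \<in> lie_product F L A B"
  unfolding lie_product_def by (rule subsetD[OF subset_span]) blast

lemma lie_product_least:
  assumes "submodule H F L" "\<And>a b. a \<in> A \<Longrightarrow> b \<in> B \<Longrightarrow> lie_bracket L a b \<in> H"
  shows "lie_product F L A B \<subseteq> H"
  unfolding lie_product_def using assms by (intro span_least) auto

end

text \<open>The descending series of L as a module under the set A, not the lower central series of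
  A. If it reaches 0, then A acts nilpotently on all of L. For an ideal this is equivalent to
  nilpotency; for a subalgebra it implies nilpotency.\<close>

primrec ad_series ::
    "('a, 'c) ring_scheme \<Rightarrow> ('a, 'b, 'd) lie_algebra_scheme \<Rightarrow> 'b set \<Rightarrow> nat \<Rightarrow> 'b set" where
  "ad_series F L A 0 = carrier L"
| "ad_series F L A (Suc k) = lie_product F L A (ad_series F L A k)"

definition ad_nilpotent :: "('a, 'b, 'd) lie_algebra_scheme \<Rightarrow> 'b \<Rightarrow> bool" where
  "ad_nilpotent L x \<longleftrightarrow> (\<exists>m. \<forall>y\<in>carrier L. (lie_bracket L x ^^ m) y = \<zero>\<^bsub>L\<^esub>)"

context lie_algebra
begin

lemma submodule_ad_series: "A \<subseteq> carrier L \<Longrightarrow> submodule (ad_series F L A k) F L"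
proof (induction k)
  case (Suc k)
  then show ?case using submodule_lie_product submodule_imp(1) by simp
qed (simp add: carrier_is_submodule)

lemma ad_series_mem:
  "a \<in> A \<Longrightarrow> v \<in> ad_series F L A k \<Longrightarrow> lie_bracket L a v \<in> ad_series F L A (Suc k)"
  using lie_bracket_mem_product by simp

lemma ad_series_Suc_subset:
  assumes "A \<subseteq> carrier L"
  shows "ad_series F L A (Suc k) \<subseteq> ad_series F L A k"
proof (induction k)
  case 0
  show ?case using submodule_imp(1)[OF submodule_ad_series[OF assms, of 1]] by simp
next
  case (Suc k)
  have "lie_product F L A (ad_series F L A (Suc k)) \<subseteq> ad_series F L A (Suc k)"
    using Suc ad_series_mem by (intro lie_product_least submodule_ad_series assms) blast
  then show ?case by simp
qed

text \<open>In [c, [a, w]] = [[c, a], w] + [a, [c, w]] the first term is again a bracket with A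
  because c normalises A, and the second is one by induction.\<close>

lemma ad_series_stable:
  assumes A: "A \<subseteq> carrier L" and c: "c \<in> carrier L" and cA: "\<And>a. a \<in> A \<Longrightarrow> lie_bracket L c a \<in> A"
    and v: "v \<in> ad_series F L A k"
  shows "lie_bracket L c v \<in> ad_series F L A k"
  using v
proof (induction k arbitrary: v)
  case 0
  then show ?case using c lie_closed by simp
next
  case (Suc k)
  note sub = submodule_imp[OF submodule_ad_series[OF A, of "Suc k"]]
  let ?H = "{v \<in> carrier L. lie_bracket L c v \<in> ad_series F L A (Suc k)}"
  have "lie_product F L A (ad_series F L A k) \<subseteq> ?H"
  proof (rule lie_product_least)
    show "submodule ?H F L"
      unfolding submodule_iff
      using c sub by (auto simp: lie_add_right lie_smult_right simp del: ad_series.simps)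
  next
    fix a w assume a: "a \<in> A" and w: "w \<in> ad_series F L A k"
    have car: "a \<in> carrier L" "w \<in> carrier L"
      using a A w submodule_imp(5)[OF submodule_ad_series[OF A, of k]] by auto
    have "lie_bracket L (lie_bracket L c a) w \<in> ad_series F L A (Suc k)"
      "lie_bracket L a (lie_bracket L c w) \<in> ad_series F L A (Suc k)"
      using ad_series_mem cA[OF a] w a Suc.IH[OF w] by blast+
    then show "lie_bracket L a w \<in> ?H"
      using lie_leibniz[OF c car] sub(3) car lie_closed by auto
  qed
  then show ?case using Suc.prems by auto
qed

text \<open>On each factor of the series of \<open>A\<close> only \<open>C\<close> acts, so \<open>m\<close> further brackets lead to the next
  term of that series.\<close>

lemma ad_series_add:
  assumes A: "A \<subseteq> carrier L" and C: "C \<subseteq> carrier L"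
    and CA: "\<And>c a. c \<in> C \<Longrightarrow> a \<in> A \<Longrightarrow> lie_bracket L c a \<in> A"
    and Cm: "ad_series F L C m = {\<zero>\<^bsub>L\<^esub>}"
    and S: "S \<subseteq> A <+>\<^bsub>L\<^esub> C"
  shows "ad_series F L S (j * m) \<subseteq> ad_series F L A j"
proof (induction j)
  case 0
  show ?case by simp
next
  case (Suc j)
  note VA = submodule_ad_series[OF A] and VC = submodule_ad_series[OF C]
  \<comment> \<open>\<open>?W i\<close> interpolates between consecutive terms of the series of A:
    it equals the j-th term for i = 0 and the next one for i = m, where the series of C
    vanishes.\<close>
  let ?W = "\<lambda>i. ad_series F L A (Suc j) <+>\<^bsub>L\<^esub> (ad_series F L C i \<inter> ad_series F L A j)"
  have W: "submodule (?W i) F L" for i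
    by (intro submodule_set_add submodule_Int VA VC)
  have "ad_series F L S (j * m + i) \<subseteq> ?W i" for i
  proof (induction i)
    case 0
    have "ad_series F L A j \<subseteq> ad_series F L C 0 \<inter> ad_series F L A j"
      using submodule_imp(1)[OF VA] by auto
    also have "\<dots> \<subseteq> ?W 0"
      by (intro subset_set_add submodule_Int VA VC)
    finally show ?case using Suc.IH by simp
  next
    case (Suc i)
    have "lie_product F L S (ad_series F L S (j * m + i)) \<subseteq> ?W (Suc i)"
    proof (rule lie_product_least[OF W])
      fix s u assume "s \<in> S" "u \<in> ad_series F L S (j * m + i)"
      then obtain a c v w where ac: "a \<in> A" "c \<in> C" "s = a \<oplus>\<^bsub>L\<^esub> c"
        and vw: "v \<in> ad_series F L A (Suc j)" "w \<in> ad_series F L C i" "w \<in> ad_series F L A j"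
          "u = v \<oplus>\<^bsub>L\<^esub> w"
        using Suc S unfolding subset_eq mem_set_add by blast
      have car: "a \<in> carrier L" "c \<in> carrier L" "v \<in> carrier L" "w \<in> carrier L"
        using ac A C submodule_imp(5)[OF VA vw(1)] submodule_imp(5)[OF VA vw(3)] by auto
      have v': "v \<in> ad_series F L A j"
        using vw(1) ad_series_Suc_subset[OF A] by blast
      have st: "lie_bracket L c x \<in> ad_series F L A k" if "x \<in> ad_series F L A k" for x k
        using ad_series_stable[OF A car(2) CA[OF ac(2)] that] .
      \<comment> \<open>The bracket with a moves one term down the series of A, and c keeps v in the
        lower term. Only [c, w] remains, and it has moved one term down the series of C.\<close>
      have "lie_bracket L s u = (lie_bracket L a (v \<oplus>\<^bsub>L\<^esub> w) \<oplus>\<^bsub>L\<^esub> lie_bracket L c v) \<oplus>\<^bsub>L\<^esub> lie_bracket L c w"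
        using car ac vw by (simp add: lie_add_left lie_add_right lie_closed M.a_ac)
      moreover have "lie_bracket L a (v \<oplus>\<^bsub>L\<^esub> w) \<oplus>\<^bsub>L\<^esub> lie_bracket L c v \<in> ad_series F L A (Suc j)"
        using ad_series_mem[OF ac(1)] submodule_imp(3)[OF VA] v' vw st by metis
      moreover have "lie_bracket L c w \<in> ad_series F L C (Suc i) \<inter> ad_series F L A j"
        using ad_series_mem[OF ac(2)] vw st by blast
      ultimately show "lie_bracket L s u \<in> ?W (Suc i)" unfolding mem_set_add by blast
    qed
    then show ?case by simp
  qed
  from this[of m] have "ad_series F L S (Suc j * m) \<subseteq> ?W m" by (simp add: add.commute)
  also have "\<dots> \<subseteq> ad_series F L A (Suc j)"
    using submodule_imp(2)[OF VA, of "Suc j"] unfolding Cm by (intro set_add_least VA) auto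
  finally show ?case .
qed

lemma ad_series_zero_mem: "A \<subseteq> carrier L \<Longrightarrow> \<zero>\<^bsub>L\<^esub> \<in> ad_series F L A k"
  using submodule_imp(2)[OF submodule_ad_series] .

lemma ad_series_zero: "ad_series F L {\<zero>\<^bsub>L\<^esub>} 1 = {\<zero>\<^bsub>L\<^esub>}"
proof -
  have "ad_series F L {\<zero>\<^bsub>L\<^esub>} 1 \<subseteq> {\<zero>\<^bsub>L\<^esub>}"
    by (simp, rule lie_product_least[OF submodule_zero]) auto
  then show ?thesis
    using ad_series_zero_mem[of "{\<zero>\<^bsub>L\<^esub>}" 1] by blast
qed

text \<open>The common step of two maximality arguments: in Engel's theorem A is a subalgebra and C
  a line normalising it; for the nilradical both are ideals.\<close>

lemma ad_series_add_nilpotent: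
  assumes "A \<subseteq> carrier L" "C \<subseteq> carrier L"
    and "\<And>c a. c \<in> C \<Longrightarrow> a \<in> A \<Longrightarrow> lie_bracket L c a \<in> A"
    and "ad_series F L C m = {\<zero>\<^bsub>L\<^esub>}" and "ad_series F L A k = {\<zero>\<^bsub>L\<^esub>}"
    and S: "S \<subseteq> A <+>\<^bsub>L\<^esub> C"
  shows "ad_series F L S (k * m) = {\<zero>\<^bsub>L\<^esub>}"
proof -
  have "S \<subseteq> carrier L"
    using S set_add_least[OF carrier_is_submodule assms(1,2)] by blast
  then show ?thesis
    using ad_series_add[OF assms(1-4) S, of k] ad_series_zero_mem assms(5) by blast
qed

section \<open>Powers of ad x and Engel's theorem\<close>

lemma ad_pow_closed: "x \<in> carrier L \<Longrightarrow> y \<in> carrier L \<Longrightarrow> (lie_bracket L x ^^ m) y \<in> carrier L"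
  by (induction m) (auto intro: lie_closed)

lemma ad_pow_linear:
  assumes "x \<in> carrier L"
  shows "y \<in> carrier L \<Longrightarrow> z \<in> carrier L \<Longrightarrow>
      (lie_bracket L x ^^ m) (y \<oplus>\<^bsub>L\<^esub> z) = (lie_bracket L x ^^ m) y \<oplus>\<^bsub>L\<^esub> (lie_bracket L x ^^ m) z"
    and "a \<in> carrier F \<Longrightarrow> y \<in> carrier L \<Longrightarrow>
      (lie_bracket L x ^^ m) (a \<odot>\<^bsub>L\<^esub> y) = a \<odot>\<^bsub>L\<^esub> (lie_bracket L x ^^ m) y"
    and "(lie_bracket L x ^^ m) \<zero>\<^bsub>L\<^esub> = \<zero>\<^bsub>L\<^esub>"
  using assms ad_pow_closed[OF assms]
  by (induction m) (simp_all add: lie_add_right lie_smult_right)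

lemma submodule_ad_pow_image:
  assumes x: "x \<in> carrier L"
  shows "submodule ((lie_bracket L x ^^ m) ` carrier L) F L"
proof -
  have "\<zero>\<^bsub>L\<^esub> \<in> (lie_bracket L x ^^ m) ` carrier L"
    using ad_pow_linear(3)[OF x] by (intro image_eqI[of _ _ "\<zero>\<^bsub>L\<^esub>"]) simp_all
  moreover have "(lie_bracket L x ^^ m) y \<oplus>\<^bsub>L\<^esub> (lie_bracket L x ^^ m) z \<in> (lie_bracket L x ^^ m) ` carrier L"
    if "y \<in> carrier L" "z \<in> carrier L" for y z
    using ad_pow_linear(1)[OF x that, of m] that by (intro image_eqI[of _ _ "y \<oplus>\<^bsub>L\<^esub> z"]) simp_all
  moreover have "a \<odot>\<^bsub>L\<^esub> (lie_bracket L x ^^ m) y \<in> (lie_bracket L x ^^ m) ` carrier L"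
    if "a \<in> carrier F" "y \<in> carrier L" for a y
    using ad_pow_linear(2)[OF x that, of m] that by (intro image_eqI[of _ _ "a \<odot>\<^bsub>L\<^esub> y"]) simp_all
  ultimately show ?thesis
    unfolding submodule_iff using ad_pow_closed[OF x] by auto
qed

lemma submodule_ad_pow_vimage:
  assumes x: "x \<in> carrier L" and J: "submodule J F L"
  shows "submodule {y \<in> carrier L. (lie_bracket L x ^^ m) y \<in> J} F L"
  unfolding submodule_iff
  using ad_pow_linear[OF x] submodule_imp[OF J] by simp

text \<open>Scalars can be pulled out of the brackets, so a line acts like the single operator ad x.
  This turns ad-nilpotency of x into nilpotent action of F x.\<close>

lemma ad_series_line:
  assumes x: "x \<in> carrier L"
  shows "ad_series F L ((\<lambda>a. a \<odot>\<^bsub>L\<^esub> x) ` carrier F) m \<subseteq> (lie_bracket L x ^^ m) ` carrier L"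
proof (induction m)
  case 0
  show ?case by simp
next
  case (Suc m)
  have "lie_product F L ((\<lambda>a. a \<odot>\<^bsub>L\<^esub> x) ` carrier F) (ad_series F L ((\<lambda>a. a \<odot>\<^bsub>L\<^esub> x) ` carrier F) m)
      \<subseteq> (lie_bracket L x ^^ Suc m) ` carrier L"
  proof (rule lie_product_least[OF submodule_ad_pow_image[OF x]])
    fix s u assume "s \<in> (\<lambda>a. a \<odot>\<^bsub>L\<^esub> x) ` carrier F" "u \<in> ad_series F L ((\<lambda>a. a \<odot>\<^bsub>L\<^esub> x) ` carrier F) m"
    then obtain a y where *: "a \<in> carrier F" "s = a \<odot>\<^bsub>L\<^esub> x" "y \<in> carrier L" "u = (lie_bracket L x ^^ m) y"
      using Suc by blast
    then have "lie_bracket L s u = (lie_bracket L x ^^ Suc m) (a \<odot>\<^bsub>L\<^esub> y)"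
      using x ad_pow_closed[OF x, of y m] ad_pow_closed[OF x, of y "Suc m"] ad_pow_linear(2)[OF x, of a y "Suc m"]
      by (simp add: lie_smult_left)
    then show "lie_bracket L s u \<in> (lie_bracket L x ^^ Suc m) ` carrier L"
      using * by blast
  qed
  then show ?case by simp
qed

text \<open>Among the subalgebras of A acting nilpotently on L a maximal one, M, is taken. If M were
  not A, some x in A outside M would normalise M, and M + F x would still be a subalgebra acting
  nilpotently.\<close>

theorem Engel:
  assumes fin: "finite_length F L" and A: "lie_subalgebra F L A"
    and nil: "\<And>x. x \<in> A \<Longrightarrow> ad_nilpotent L x"
  shows "\<exists>k. ad_series F L A k = {\<zero>\<^bsub>L\<^esub>}"
proof -
  note A' = lie_subalgebra_imp[OF A]
  let ?P = "\<lambda>M. lie_subalgebra F L M \<and> M \<subseteq> A \<and> (\<exists>k. ad_series F L M k = {\<zero>\<^bsub>L\<^esub>})"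
  have "?P {\<zero>\<^bsub>L\<^esub>}"
    using lie_ideal_imp_subalgebra[OF lie_ideal_zero] submodule_imp(2)[OF A'(1)] ad_series_zero
    by blast
  then obtain M where M: "?P M" and max: "\<And>K. ?P K \<Longrightarrow> M \<subseteq> K \<Longrightarrow> K = M"
    using finite_length_maximal[of ?P, OF fin] lie_subalgebra_imp(1) by (smt (verit))
  then obtain k where k: "ad_series F L M k = {\<zero>\<^bsub>L\<^esub>}" by blast
  have M': "submodule M F L" "M \<subseteq> carrier L" "\<And>x y. x \<in> M \<Longrightarrow> y \<in> M \<Longrightarrow> lie_bracket L x y \<in> M" "M \<subseteq> A"
    using M lie_subalgebra_imp by auto
  have "M = A"
  proof (rule ccontr)
    assume "M \<noteq> A"
    \<comment> \<open>\<open>?T\<close> fails at 0 because M \<noteq> A and holds at k because the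
      series has reached 0. Where it switches from false to true there is an x in A outside M with
      [M, x] contained in M.\<close>
    let ?T = "\<lambda>j. ad_series F L M j \<inter> A \<subseteq> M"
    have "\<not> ?T 0" using \<open>M \<noteq> A\<close> M'(4) A'(2) by auto
    moreover have "?T k" using k submodule_imp(2)[OF M'(1)] by auto
    ultimately obtain j where "\<not> ?T j" "?T (Suc j)"
      using nat_induct[of "\<lambda>j. \<not> ?T j" k] by blast
    then obtain x where x: "x \<in> ad_series F L M j" "x \<in> A" "x \<notin> M" by blast
    have xL: "x \<in> carrier L" using x A' by blast
    have Mx: "lie_bracket L m x \<in> M" if "m \<in> M" for m
      using ad_series_mem[OF that x(1)] A'(3)[of m x] x that M'(4) \<open>?T (Suc j)\<close> by blast
    have xM: "lie_bracket L x m \<in> M" if "m \<in> M" for m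
      using lie_anticomm[of m x] Mx[OF that] xL that M'(2) submodule_imp(6)[OF M'(1)] by auto
    define C where "C = (\<lambda>a. a \<odot>\<^bsub>L\<^esub> x) ` carrier F"
    have C: "submodule C F L" unfolding C_def using xL by (rule submodule_line)
    have CA: "C \<subseteq> A" unfolding C_def using submodule_imp(4)[OF A'(1)] x by blast
    have CM: "lie_bracket L c m \<in> M" if "c \<in> C" "m \<in> M" for c m
    proof -
      obtain a where "a \<in> carrier F" "c = a \<odot>\<^bsub>L\<^esub> x" using \<open>c \<in> C\<close> C_def by blast
      then show ?thesis
        using lie_smult_left[of a x m] xL \<open>m \<in> M\<close> M'(2) xM[OF \<open>m \<in> M\<close>] submodule_imp(4)[OF M'(1)] by auto
    qed
    have MC: "lie_bracket L m c \<in> M" if "c \<in> C" "m \<in> M" for c m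
    proof -
      have "c \<in> carrier L" "m \<in> carrier L" using that M'(2) submodule_imp(1)[OF C] by auto
      then show ?thesis
        using lie_anticomm[of c m] CM[OF that] submodule_imp(6)[OF M'(1)] by simp
    qed
    \<comment> \<open>The line C is abelian because [x, x] = 0, so brackets of elements of M + C
      fall into M itself.\<close>
    have CC: "lie_bracket L c d = \<zero>\<^bsub>L\<^esub>" if "c \<in> C" "d \<in> C" for c d
      using that xL by (auto simp: C_def lie_smult_left lie_smult_right lie_alternating)
    obtain m where "\<forall>y\<in>carrier L. (lie_bracket L x ^^ m) y = \<zero>\<^bsub>L\<^esub>"
      using nil[OF x(2)] unfolding ad_nilpotent_def by blast
    then have Cm: "ad_series F L C m = {\<zero>\<^bsub>L\<^esub>}"
      using ad_series_line[OF xL, of m] ad_series_zero_mem[of C m] submodule_imp(1)[OF C]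
      unfolding C_def by auto
    have "lie_bracket L u v \<in> M <+>\<^bsub>L\<^esub> C" if uv: "u \<in> M <+>\<^bsub>L\<^esub> C" "v \<in> M <+>\<^bsub>L\<^esub> C" for u v
    proof -
      obtain a c b d where *: "a \<in> M" "c \<in> C" "u = a \<oplus>\<^bsub>L\<^esub> c" "b \<in> M" "d \<in> C" "v = b \<oplus>\<^bsub>L\<^esub> d"
        using uv unfolding mem_set_add by blast
      have car: "a \<in> carrier L" "b \<in> carrier L" "c \<in> carrier L" "d \<in> carrier L"
        using * M'(2) submodule_imp(1)[OF C] by auto
      have "lie_bracket L u v = lie_bracket L a b \<oplus>\<^bsub>L\<^esub> lie_bracket L a d \<oplus>\<^bsub>L\<^esub> lie_bracket L c b"
        using * car CC[OF \<open>c \<in> C\<close> \<open>d \<in> C\<close>] by (simp add: lie_add_left lie_add_right lie_closed M.a_ac)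
      also have "\<dots> \<in> M"
        using * M'(3) CM MC submodule_imp(3)[OF M'(1)] by simp
      finally show ?thesis using subset_set_add(1)[OF M'(1) C] by blast
    qed
    then have "?P (M <+>\<^bsub>L\<^esub> C)"
      using submodule_set_add[OF M'(1) C] set_add_least[OF A'(1) M'(4) CA]
        ad_series_add_nilpotent[OF M'(2) submodule_imp(1)[OF C] CM Cm k order_refl]
      unfolding lie_subalgebra_def by blast
    then have "C \<subseteq> M"
      using max subset_set_add[OF M'(1) C] by blast
    moreover have "x \<in> C"
      unfolding C_def using xL by (intro image_eqI[of _ _ \<one>]) auto
    ultimately show False using x by blast
  qed
  then show ?thesis using k by blast
qed

section \<open>Nilpotent subalgebras and the nilradical\<close>

lemma lower_central_series_restrict:
  assumes U: "lie_subalgebra F L U"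
  shows "submodule (lower_central_series F (lie_restrict L U) k) F L"
    and "lower_central_series F (lie_restrict L U) k \<subseteq> U"
    and "lower_central_series F (lie_restrict L U) (Suc k) =
      lie_product F L U (lower_central_series F (lie_restrict L U) k)"
proof -
  note U' = lie_subalgebra_imp[OF U]
  \<comment> \<open>Spans of brackets taken inside U agree with those taken in L, so the lower
    central series of U becomes comparable with series of the ambient algebra.\<close>
  have step: "lie_product F (lie_restrict L U) U H = lie_product F L U H"
    if "H \<subseteq> U" for H
    unfolding lie_product_def using U'(3) that by (simp, intro span_restrict[OF U'(1)]) blast
  have *: "submodule (lower_central_series F (lie_restrict L U) k) F L \<and>
    lower_central_series F (lie_restrict L U) k \<subseteq> U" for k
  proof (induction k)
    case 0
    show ?case using U' by simp
  next
    case (Suc k)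
    have "lie_product F L U (lower_central_series F (lie_restrict L U) k) \<subseteq> U"
      using Suc U' by (intro lie_product_least) auto
    moreover have "submodule (lie_product F L U (lower_central_series F (lie_restrict L U) k)) F L"
      using Suc U'(2) by (intro submodule_lie_product) auto
    ultimately show ?case using step Suc by simp
  qed
  then show "submodule (lower_central_series F (lie_restrict L U) k) F L"
    and "lower_central_series F (lie_restrict L U) k \<subseteq> U" by auto
  show "lower_central_series F (lie_restrict L U) (Suc k) =
      lie_product F L U (lower_central_series F (lie_restrict L U) k)"
    using step * by simp
qed

lemma lower_central_series_subset_ad_series:
  assumes U: "lie_subalgebra F L U"
  shows "lower_central_series F (lie_restrict L U) k \<subseteq> ad_series F L U k"
proof (induction k)
  case 0
  show ?case using lie_subalgebra_imp(2)[OF U] by simp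
next
  case (Suc k)
  then show ?case
    unfolding lower_central_series_restrict(3)[OF U]
    using ad_series_mem
    by (intro lie_product_least submodule_ad_series lie_subalgebra_imp(2)[OF U]) blast
qed

text \<open>The shift by one comes from the first bracket, which carries L into I; from there on
  both series take the same brackets.\<close>

lemma ad_series_subset_lower_central_series:
  assumes I: "lie_ideal F L I"
  shows "ad_series F L I (Suc k) \<subseteq> lower_central_series F (lie_restrict L I) k"
proof (induction k)
  case 0
  have "lie_product F L I (carrier L) \<subseteq> I"
    using lie_ideal_imp[OF I] by (intro lie_product_least) auto
  then show ?case by simp
next
  case (Suc k)
  note U = lie_ideal_imp_subalgebra[OF I]
  have "lie_product F L I (ad_series F L I (Suc k)) \<subseteq> lower_central_series F (lie_restrict L I) (Suc k)"
    using Suc lower_central_series_restrict(1)[OF U, of "Suc k"] lie_bracket_mem_product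
    unfolding lower_central_series_restrict(3)[OF U]
    by (intro lie_product_least) auto
  then show ?case by simp
qed

lemma lie_nilpotent_restrictI:
  assumes U: "lie_subalgebra F L U" and "ad_series F L U k = {\<zero>\<^bsub>L\<^esub>}"
  shows "lie_nilpotent F (lie_restrict L U)"
proof -
  have "lower_central_series F (lie_restrict L U) k = {\<zero>\<^bsub>L\<^esub>}"
    using lower_central_series_subset_ad_series[OF U, of k] assms(2)
      submodule_imp(2)[OF lower_central_series_restrict(1)[OF U, of k]] by blast
  then show ?thesis unfolding lie_nilpotent_def by auto
qed

lemma lie_nilpotent_ideal_iff:
  assumes I: "lie_ideal F L I"
  shows "lie_nilpotent F (lie_restrict L I) \<longleftrightarrow> (\<exists>k. ad_series F L I k = {\<zero>\<^bsub>L\<^esub>})"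
proof
  assume "lie_nilpotent F (lie_restrict L I)"
  then obtain k where "lower_central_series F (lie_restrict L I) k = {\<zero>\<^bsub>L\<^esub>}"
    unfolding lie_nilpotent_def by auto
  then have "ad_series F L I (Suc k) = {\<zero>\<^bsub>L\<^esub>}"
    using ad_series_subset_lower_central_series[OF I, of k]
      ad_series_zero_mem[OF lie_ideal_imp(2)[OF I], of "Suc k"] by blast
  then show "\<exists>k. ad_series F L I k = {\<zero>\<^bsub>L\<^esub>}" by blast
next
  assume "\<exists>k. ad_series F L I k = {\<zero>\<^bsub>L\<^esub>}"
  then show "lie_nilpotent F (lie_restrict L I)"
    using lie_nilpotent_restrictI[OF lie_ideal_imp_subalgebra[OF I]] by blast
qed

text \<open>The nilradical is defined as the span of a possibly infinite union. A maximal ideal I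
  with nilpotent action absorbs every other such ideal K, because I + K is again one; hence the
  union is I and its span adds nothing.\<close>

theorem nilradical_nilpotent_ideal:
  assumes fin: "finite_length F L"
  shows "lie_ideal F L (nilradical F L)" and "\<exists>k. ad_series F L (nilradical F L) k = {\<zero>\<^bsub>L\<^esub>}"
proof -
  let ?P = "\<lambda>I. lie_ideal F L I \<and> (\<exists>k. ad_series F L I k = {\<zero>\<^bsub>L\<^esub>})"
  have "?P {\<zero>\<^bsub>L\<^esub>}" using lie_ideal_zero ad_series_zero by blast
  then obtain I where I: "?P I" and max: "\<And>K. ?P K \<Longrightarrow> I \<subseteq> K \<Longrightarrow> K = I"
    using finite_length_maximal[of ?P, OF fin] lie_ideal_imp(1) by (smt (verit))
  then obtain k where k: "ad_series F L I k = {\<zero>\<^bsub>L\<^esub>}" by blast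
  have I': "lie_ideal F L I" using I by blast
  have "K \<subseteq> I" if "?P K" for K
  proof -
    obtain m where K: "lie_ideal F L K" "ad_series F L K m = {\<zero>\<^bsub>L\<^esub>}" using \<open>?P K\<close> by blast
    have "ad_series F L (I <+>\<^bsub>L\<^esub> K) (k * m) = {\<zero>\<^bsub>L\<^esub>}"
      using lie_ideal_imp[OF I'] lie_ideal_imp[OF K(1)]
      by (intro ad_series_add_nilpotent[OF _ _ _ K(2) k]) auto
    then have "I <+>\<^bsub>L\<^esub> K = I"
      using max lie_ideal_add[OF I' K(1)] subset_set_add[OF lie_ideal_imp(1)[OF I'] lie_ideal_imp(1)[OF K(1)]]
      by blast
    then show "K \<subseteq> I"
      using subset_set_add[OF lie_ideal_imp(1)[OF I'] lie_ideal_imp(1)[OF K(1)]] by simp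
  qed
  then have "\<Union>{I. lie_ideal F L I \<and> lie_nilpotent F (lie_restrict L I)} = I"
    using I lie_nilpotent_ideal_iff by blast
  then have "nilradical F L = I"
    unfolding nilradical_def
    using span_least[OF lie_ideal_imp(1)[OF I'], of I] subset_span[of I] by auto
  then show "lie_ideal F L (nilradical F L)" "\<exists>k. ad_series F L (nilradical F L) k = {\<zero>\<^bsub>L\<^esub>}"
    using I by auto
qed

lemma ad_pow_mem_ad_series:
  assumes "x \<in> A" "y \<in> carrier L"
  shows "(lie_bracket L x ^^ k) y \<in> ad_series F L A k"
proof (induction k)
  case (Suc k)
  then show ?case using ad_series_mem[OF assms(1)] by simp
qed (use assms in simp)

lemma nilradical_ad_nilpotent:
  assumes "finite_length F L" "x \<in> nilradical F L"
  shows "ad_nilpotent L x"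
  using nilradical_nilpotent_ideal(2)[OF assms(1)] ad_pow_mem_ad_series[OF assms(2)]
  unfolding ad_nilpotent_def by blast

end

section \<open>Quotients and the upper nilpotent series\<close>

locale lie_quotient_algebra = lie_algebra +
  fixes J
  assumes ideal: "lie_ideal F L J"
begin

abbreviation Q where "Q \<equiv> lie_quotient L J"
abbreviation proj where "proj x \<equiv> J +>\<^bsub>L\<^esub> x"
abbreviation pre where "pre H \<equiv> {x \<in> carrier L. proj x \<in> H}"

lemmas J = lie_ideal_imp[OF ideal] submodule_imp(2,3,4,5,6,7)[OF lie_ideal_imp(1)[OF ideal]]

lemma additive_J: "abelian_subgroup J L"
  using J(1) by (intro abelian_subgroupI3 additive_subgroupI submodule.axioms(1) M.abelian_group_axioms)

lemma mem_coset:
  assumes "x \<in> carrier L"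
  shows "y \<in> proj x \<longleftrightarrow> y \<in> carrier L \<and> y \<ominus>\<^bsub>L\<^esub> x \<in> J"
proof
  assume "y \<in> proj x"
  then obtain h where "h \<in> J" "y = h \<oplus>\<^bsub>L\<^esub> x" unfolding a_r_coset_def' by blast
  then show "y \<in> carrier L \<and> y \<ominus>\<^bsub>L\<^esub> x \<in> J"
    using assms J(8) by (simp add: a_minus_def M.a_assoc M.r_neg)
next
  assume "y \<in> carrier L \<and> y \<ominus>\<^bsub>L\<^esub> x \<in> J"
  moreover from this have "y = (y \<ominus>\<^bsub>L\<^esub> x) \<oplus>\<^bsub>L\<^esub> x"
    using assms by (simp add: a_minus_def M.a_assoc M.l_neg)
  ultimately show "y \<in> proj x" unfolding a_r_coset_def' by blast
qed

lemma coset_eq_iff: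
  assumes "x \<in> carrier L" "y \<in> carrier L"
  shows "proj x = proj y \<longleftrightarrow> x \<ominus>\<^bsub>L\<^esub> y \<in> J"
proof
  assume "proj x = proj y"
  moreover have "x \<in> proj x" using mem_coset[OF assms(1)] assms(1) J(5) by (simp add: a_minus_def M.r_neg)
  ultimately show "x \<ominus>\<^bsub>L\<^esub> y \<in> J" using mem_coset[OF assms(2)] by blast
next
  assume "x \<ominus>\<^bsub>L\<^esub> y \<in> J"
  then have "x \<in> proj y" using mem_coset[OF assms(2)] assms(1) by blast
  then show "proj x = proj y"
    using M.a_repr_independence[of x J y] assms(2) submodule.axioms(1)[OF J(1)] by simp
qed

lemma coset_self: "x \<in> carrier L \<Longrightarrow> x \<in> proj x"
  using mem_coset[of x x] J(5) by (simp add: a_minus_def M.r_neg)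

lemma coset_eq_J_iff:
  assumes "x \<in> carrier L"
  shows "proj x = J \<longleftrightarrow> x \<in> J"
  using M.a_coset_join2[OF assms submodule.axioms(1)[OF J(1)]] coset_self[OF assms] by blast

lemma carrier_quotient: "carrier Q = proj ` carrier L"
  unfolding lie_quotient_def A_RCOSETS_def' by auto

lemma zero_quotient: "\<zero>\<^bsub>Q\<^esub> = J"
  unfolding lie_quotient_def by simp

lemma add_quotient:
  "x \<in> carrier L \<Longrightarrow> y \<in> carrier L \<Longrightarrow> proj x \<oplus>\<^bsub>Q\<^esub> proj y = proj (x \<oplus>\<^bsub>L\<^esub> y)"
  unfolding lie_quotient_def using abelian_subgroup.a_rcos_sum[OF additive_J] by simp

text \<open>The union in \<open>lie_quotient\<close> runs over all representatives. From a y - a x =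
  a (y - x) in J it follows that its members are one and the same coset.\<close>

lemma smult_quotient:
  assumes "a \<in> carrier F" "x \<in> carrier L"
  shows "a \<odot>\<^bsub>Q\<^esub> proj x = proj (a \<odot>\<^bsub>L\<^esub> x)"
proof -
  have "proj (a \<odot>\<^bsub>L\<^esub> y) = proj (a \<odot>\<^bsub>L\<^esub> x)" if "y \<in> proj x" for y
  proof -
    have y: "y \<in> carrier L" "y \<ominus>\<^bsub>L\<^esub> x \<in> J" using that mem_coset[OF assms(2)] by auto
    have "a \<odot>\<^bsub>L\<^esub> y \<ominus>\<^bsub>L\<^esub> a \<odot>\<^bsub>L\<^esub> x = a \<odot>\<^bsub>L\<^esub> (y \<ominus>\<^bsub>L\<^esub> x)"
      using assms y by (simp add: a_minus_def smult_r_distr smult_r_minus)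
    then show ?thesis using coset_eq_iff assms y J(7) by simp
  qed
  then have "(\<Union>y\<in>proj x. proj (a \<odot>\<^bsub>L\<^esub> y)) = proj (a \<odot>\<^bsub>L\<^esub> x)"
    by (rule SUP_eq_const[rotated]) (use coset_self[OF assms(2)] in blast)+
  then show ?thesis by (simp add: lie_quotient_def)
qed

text \<open>For u = g + x and v = h + y with g, h in J, the difference [u, v] - [x, y] = [g, v] +
  [x, h] lies in J. Both summands need J to be an ideal.\<close>

lemma bracket_quotient:
  assumes "x \<in> carrier L" "y \<in> carrier L"
  shows "lie_bracket Q (proj x) (proj y) = proj (lie_bracket L x y)"
proof -
  have "proj (lie_bracket L u v) = proj (lie_bracket L x y)" if "u \<in> proj x" "v \<in> proj y" for u v
  proof -
    have u: "u \<in> carrier L" "u \<ominus>\<^bsub>L\<^esub> x \<in> J" and v: "v \<in> carrier L" "v \<ominus>\<^bsub>L\<^esub> y \<in> J"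
      using that mem_coset assms by auto
    define g h where "g = u \<ominus>\<^bsub>L\<^esub> x" and "h = v \<ominus>\<^bsub>L\<^esub> y"
    have gh: "g \<in> J" "h \<in> J" "u = g \<oplus>\<^bsub>L\<^esub> x" "v = h \<oplus>\<^bsub>L\<^esub> y"
      using u v assms by (simp_all add: g_def h_def a_minus_def M.a_assoc M.l_neg)
    have car: "g \<in> carrier L" "h \<in> carrier L" using gh J(8) by auto
    have "lie_bracket L u v = (lie_bracket L g v \<oplus>\<^bsub>L\<^esub> lie_bracket L x h) \<oplus>\<^bsub>L\<^esub> lie_bracket L x y"
      using gh(3,4) car assms by (simp add: lie_add_left lie_add_right lie_closed M.a_ac)
    then have "lie_bracket L u v \<ominus>\<^bsub>L\<^esub> lie_bracket L x y = lie_bracket L g v \<oplus>\<^bsub>L\<^esub> lie_bracket L x h"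
      using car assms v by (simp add: a_minus_def M.a_assoc M.r_neg lie_closed)
    moreover have "\<dots> \<in> J" using J(3,4,6) gh(1,2) v assms by simp
    ultimately show ?thesis using coset_eq_iff assms u v lie_closed by simp
  qed
  then have "(\<Union>v\<in>proj y. proj (lie_bracket L u v)) = proj (lie_bracket L x y)" if "u \<in> proj x" for u
    by (rule SUP_eq_const[rotated]) (use that coset_self[OF assms(2)] in blast)+
  then have "(\<Union>u\<in>proj x. \<Union>v\<in>proj y. proj (lie_bracket L u v)) = proj (lie_bracket L x y)"
    by (rule SUP_eq_const[rotated]) (use coset_self[OF assms(1)] in blast)+
  then show ?thesis by (simp add: lie_quotient_def)
qed

lemma lie_algebra_quotient: "lie_algebra F Q"
proof -
  note ops = zero_quotient add_quotient smult_quotient bracket_quotient lie_closed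
  have "abelian_group Q"
  proof (rule abelian_groupI)
    fix X assume "X \<in> carrier Q"
    then obtain x where x: "x \<in> carrier L" "X = proj x" unfolding carrier_quotient by blast
    then have "proj (\<ominus>\<^bsub>L\<^esub> x) \<oplus>\<^bsub>Q\<^esub> X = \<zero>\<^bsub>Q\<^esub>"
      using J(2) by (simp add: add_quotient M.l_neg zero_quotient)
    then show "\<exists>Y\<in>carrier Q. Y \<oplus>\<^bsub>Q\<^esub> X = \<zero>\<^bsub>Q\<^esub>"
      using x unfolding carrier_quotient by blast
    have "proj \<zero>\<^bsub>L\<^esub> \<oplus>\<^bsub>Q\<^esub> X = X" using x by (simp only: add_quotient M.zero_closed M.l_zero)
    then show "\<zero>\<^bsub>Q\<^esub> \<oplus>\<^bsub>Q\<^esub> X = X" using J(2) by (simp add: zero_quotient)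
  next
    show "\<zero>\<^bsub>Q\<^esub> \<in> carrier Q"
      using J(2) by (auto simp: carrier_quotient zero_quotient intro!: image_eqI[of _ _ "\<zero>\<^bsub>L\<^esub>"])
  qed (auto simp: carrier_quotient add_quotient M.a_ac)
  then have "module F Q"
    by (intro moduleI R.is_cring)
      (auto simp: carrier_quotient add_quotient smult_quotient smult_l_distr smult_r_distr smult_assoc1)
  moreover have "lie_algebra_axioms F Q"
  proof
    fix X assume "X \<in> carrier Q"
    then show "lie_bracket Q X X = \<zero>\<^bsub>Q\<^esub>"
      using J(2) by (auto simp: carrier_quotient bracket_quotient lie_alternating zero_quotient)
  next
    fix X Y Z assume "X \<in> carrier Q" "Y \<in> carrier Q" "Z \<in> carrier Q"
    then show "lie_bracket Q X (lie_bracket Q Y Z) \<oplus>\<^bsub>Q\<^esub> lie_bracket Q Y (lie_bracket Q Z X)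
         \<oplus>\<^bsub>Q\<^esub> lie_bracket Q Z (lie_bracket Q X Y) = \<zero>\<^bsub>Q\<^esub>"
      using J(2) by (auto simp: carrier_quotient bracket_quotient add_quotient lie_closed lie_jacobi
          zero_quotient)
  qed (auto simp: carrier_quotient bracket_quotient add_quotient smult_quotient lie_closed
      lie_add_left lie_add_right lie_smult_left lie_smult_right)
  ultimately show ?thesis by (intro lie_algebra.intro field_axioms)
qed

lemma submodule_pre:
  assumes "submodule H F Q"
  shows "submodule (pre H) F L" "J \<subseteq> pre H" "proj ` pre H = H"
proof -
  interpret Q: lie_algebra F Q by (rule lie_algebra_quotient)
  note H = Q.submodule_imp[OF assms]
  have 0: "proj \<zero>\<^bsub>L\<^esub> \<in> H" using H(2) J(2) by (simp add: zero_quotient)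
  show "submodule (pre H) F L"
    unfolding submodule_iff
    using 0 H(3,4) by (auto simp flip: add_quotient smult_quotient)
  show "J \<subseteq> pre H"
  proof
    fix x assume "x \<in> J"
    then have "x \<in> carrier L" "proj x = J" using coset_eq_J_iff J(8) by auto
    then show "x \<in> pre H" using H(2) by (simp add: zero_quotient)
  qed
  show "proj ` pre H = H"
    using H(1) unfolding carrier_quotient by auto
qed

lemma submodule_image:
  assumes "submodule M F L"
  shows "submodule (proj ` M) F Q"
proof -
  interpret Q: lie_algebra F Q by (rule lie_algebra_quotient)
  note M = submodule_imp[OF assms]
  have "\<zero>\<^bsub>Q\<^esub> \<in> proj ` M"
    using M(2) J(2) by (intro image_eqI[of _ _ "\<zero>\<^bsub>L\<^esub>"]) (auto simp: zero_quotient)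
  then show ?thesis
    unfolding Q.submodule_iff
    using M by (auto simp: carrier_quotient add_quotient smult_quotient)
qed

lemma pre_image:
  assumes "submodule M F L" "J \<subseteq> M"
  shows "pre (proj ` M) = M"
proof
  show "pre (proj ` M) \<subseteq> M"
  proof
    fix x assume "x \<in> pre (proj ` M)"
    then obtain y where xy: "x \<in> carrier L" "y \<in> M" "proj x = proj y" by blast
    have "y \<in> carrier L" using xy submodule_imp(5)[OF assms(1)] by blast
    then have "x \<ominus>\<^bsub>L\<^esub> y \<in> M" using xy coset_eq_iff assms(2) by blast
    then have "(x \<ominus>\<^bsub>L\<^esub> y) \<oplus>\<^bsub>L\<^esub> y \<in> M" using submodule_imp(3)[OF assms(1)] xy by blast
    then show "x \<in> M"
      using xy \<open>y \<in> carrier L\<close> by (simp add: a_minus_def M.a_assoc M.l_neg)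
  qed
qed (use submodule_imp(1)[OF assms(1)] in auto)

lemma mem_image_iff:
  assumes "submodule M F L" "J \<subseteq> M" "x \<in> carrier L"
  shows "proj x \<in> proj ` M \<longleftrightarrow> x \<in> M"
  using pre_image[OF assms(1,2)] assms(3) by blast

text \<open>The rank of a submodule of the quotient is that of its preimage; it stays strict because
  a submodule is recovered as the image of its preimage.\<close>

lemma finite_length_quotient:
  assumes "finite_length F L"
  shows "finite_length F Q"
proof -
  obtain rk :: "_ \<Rightarrow> nat" where
    rk: "\<And>H K. submodule H F L \<Longrightarrow> submodule K F L \<Longrightarrow> H \<subset> K \<Longrightarrow> rk H < rk K"
    using assms(1) unfolding finite_length_def by blast
  show ?thesis
    unfolding finite_length_def
  proof (intro exI[of _ "\<lambda>H. rk (pre H)"] allI impI, elim conjE)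
    fix H K assume HK: "submodule H F Q" "submodule K F Q" "H \<subset> K"
    have "pre H \<noteq> pre K"
    proof
      assume "pre H = pre K"
      then have "proj ` pre H = proj ` pre K" by (rule arg_cong)
      then show False
        using HK(3) unfolding submodule_pre(3)[OF HK(1)] submodule_pre(3)[OF HK(2)] by blast
    qed
    then have "pre H \<subset> pre K" using HK(3) by (intro psubsetI) auto
    then show "rk (pre H) < rk (pre K)"
      by (rule rk[OF submodule_pre(1)[OF HK(1)] submodule_pre(1)[OF HK(2)]])
  qed
qed

lemma lie_subalgebra_pre:
  assumes "lie_subalgebra F Q H"
  shows "lie_subalgebra F L (pre H)"
  using assms submodule_pre(1)[of H] lie_closed
  unfolding lie_subalgebra_def by (auto simp flip: bracket_quotient)

lemma lie_subalgebra_image: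
  assumes "lie_subalgebra F L M"
  shows "lie_subalgebra F Q (proj ` M)"
  using lie_subalgebra_imp[OF assms] submodule_image[of M] bracket_quotient
  unfolding lie_subalgebra_def by (auto simp: subset_iff)

lemma lie_ideal_pre:
  assumes "lie_ideal F Q H"
  shows "lie_ideal F L (pre H)"
  using assms submodule_pre(1)[of H] lie_closed
  unfolding lie_ideal_def carrier_quotient by (auto simp flip: bracket_quotient)

lemma ad_pow_quotient:
  assumes "x \<in> carrier L" "y \<in> carrier L"
  shows "(lie_bracket Q (proj x) ^^ m) (proj y) = proj ((lie_bracket L x ^^ m) y)"
  by (induction m) (simp_all add: bracket_quotient ad_pow_closed assms)

text \<open>Maximal subalgebras of L/J correspond to maximal subalgebras of L containing J. After
  this, Frattini subalgebras of quotients are handled entirely inside L.\<close>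

lemma proj_mem_frattini_iff:
  assumes "x \<in> carrier L"
  shows "proj x \<in> frattini F Q \<longleftrightarrow> (\<forall>M. maximal_lie_subalgebra F L M \<and> J \<subseteq> M \<longrightarrow> x \<in> M)"
proof
  assume x: "proj x \<in> frattini F Q"
  show "\<forall>M. maximal_lie_subalgebra F L M \<and> J \<subseteq> M \<longrightarrow> x \<in> M"
  proof (intro allI impI, elim conjE)
    fix M assume M: "maximal_lie_subalgebra F L M" "J \<subseteq> M"
    then have M': "lie_subalgebra F L M" "M \<noteq> carrier L"
      and max: "\<And>K. lie_subalgebra F L K \<Longrightarrow> M \<subseteq> K \<Longrightarrow> K = M \<or> K = carrier L"
      unfolding maximal_lie_subalgebra_def by auto
    note sub = lie_subalgebra_imp[OF M'(1)]
    have "maximal_lie_subalgebra F Q (proj ` M)"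
      unfolding maximal_lie_subalgebra_def
    proof (intro conjI allI impI)
      show "lie_subalgebra F Q (proj ` M)" using lie_subalgebra_image[OF M'(1)] .
      show "proj ` M \<noteq> carrier Q"
        using pre_image[OF sub(1) M(2)] M'(2) unfolding carrier_quotient by auto
    next
      fix K assume "lie_subalgebra F Q K \<and> proj ` M \<subseteq> K"
      then have K: "lie_subalgebra F Q K" "proj ` M \<subseteq> K" by auto
      from K have "submodule K F Q" unfolding lie_subalgebra_def by blast
      note K' = submodule_pre[OF this]
      have "pre K = M \<or> pre K = carrier L"
        using max[OF lie_subalgebra_pre[OF K(1)]] K(2) sub(2) by blast
      then have "proj ` pre K = proj ` M \<or> proj ` pre K = proj ` carrier L"
        by (rule disj_forward) (rule arg_cong, assumption)+
      then show "K = proj ` M \<or> K = carrier Q"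
        unfolding K'(3) carrier_quotient .
    qed
    then have "proj x \<in> proj ` M" using x unfolding frattini_def by blast
    then show "x \<in> M" using mem_image_iff[OF sub(1) M(2) assms] by blast
  qed
next
  assume x: "\<forall>M. maximal_lie_subalgebra F L M \<and> J \<subseteq> M \<longrightarrow> x \<in> M"
  have "proj x \<in> H" if H: "maximal_lie_subalgebra F Q H" for H
  proof -
    have H': "lie_subalgebra F Q H" "H \<noteq> carrier Q"
      and max: "\<And>K. lie_subalgebra F Q K \<Longrightarrow> H \<subseteq> K \<Longrightarrow> K = H \<or> K = carrier Q"
      using H unfolding maximal_lie_subalgebra_def by auto
    then have "submodule H F Q" unfolding lie_subalgebra_def by blast
    note sub = submodule_pre[OF this]
    have "maximal_lie_subalgebra F L (pre H)"
      unfolding maximal_lie_subalgebra_def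
    proof (intro conjI allI impI)
      show "lie_subalgebra F L (pre H)" using lie_subalgebra_pre[OF H'(1)] .
      show "pre H \<noteq> carrier L"
        using sub(3) H'(2) unfolding carrier_quotient by metis
    next
      fix K assume "lie_subalgebra F L K \<and> pre H \<subseteq> K"
      then have K: "lie_subalgebra F L K" "pre H \<subseteq> K" by auto
      note K' = lie_subalgebra_imp[OF K(1)]
      have "pre (proj ` K) = K" using pre_image[OF K'(1)] K(2) sub(2) by blast
      moreover have "H \<subseteq> proj ` K" using sub(3) K(2) by blast
      then have "proj ` K = H \<or> proj ` K = carrier Q"
        using max[OF lie_subalgebra_image[OF K(1)]] by blast
      ultimately show "K = pre H \<or> K = carrier L" unfolding carrier_quotient by auto
    qed
    then show ?thesis using x sub(2) by blast
  qed
  then show "proj x \<in> frattini F Q"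
    unfolding frattini_def carrier_quotient using assms by blast
qed

end

section \<open>The upper nilpotent series and the Frattini series, described inside L\<close>

context lie_algebra
begin

lemma lie_ideal_upper_nilpotent_series:
  assumes "finite_length F L"
  shows "lie_ideal F L (upper_nilpotent_series F L i)"
proof (induction i)
  case 0
  show ?case using lie_ideal_zero by simp
next
  case (Suc i)
  interpret N: lie_quotient_algebra F L "upper_nilpotent_series F L i"
    by unfold_locales (rule Suc)
  show ?case
    using N.lie_ideal_pre[OF lie_algebra.nilradical_nilpotent_ideal(1)[OF N.lie_algebra_quotient
      N.finite_length_quotient[OF assms]]] by simp
qed

lemma upper_nilpotent_series_Suc_subset:
  assumes "finite_length F L"
  shows "upper_nilpotent_series F L i \<subseteq> upper_nilpotent_series F L (Suc i)"
proof -
  interpret N: lie_quotient_algebra F L "upper_nilpotent_series F L i"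
    by unfold_locales (rule lie_ideal_upper_nilpotent_series[OF assms])
  have "submodule (nilradical F N.Q) F N.Q"
    using lie_algebra.nilradical_nilpotent_ideal(1)[OF N.lie_algebra_quotient
      N.finite_length_quotient[OF assms]] unfolding lie_ideal_def by blast
  then show ?thesis using N.submodule_pre(2) by simp
qed

lemma upper_nilpotent_series_mono:
  assumes "finite_length F L" "i \<le> j"
  shows "upper_nilpotent_series F L i \<subseteq> upper_nilpotent_series F L j"
  using assms(2) upper_nilpotent_series_Suc_subset[OF assms(1)] by (rule lift_Suc_mono_le[rotated])

text \<open>The image of x lies in the nilradical of L/N_i, whose elements are ad-nilpotent, and
  powers of ad commute with the projection. This is the source of the nilpotency of the summands
  B_{i+1}.\<close>

lemma upper_nilpotent_series_ad:
  assumes "finite_length F L" and x: "x \<in> upper_nilpotent_series F L (Suc i)"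
  shows "\<exists>m. \<forall>y\<in>carrier L. (lie_bracket L x ^^ m) y \<in> upper_nilpotent_series F L i"
proof -
  interpret N: lie_quotient_algebra F L "upper_nilpotent_series F L i"
    by unfold_locales (rule lie_ideal_upper_nilpotent_series[OF assms(1)])
  have xL: "x \<in> carrier L" and "N.proj x \<in> nilradical F N.Q" using x by auto
  then have "ad_nilpotent N.Q (N.proj x)"
    by (intro lie_algebra.nilradical_ad_nilpotent[OF N.lie_algebra_quotient]
        N.finite_length_quotient assms(1))
  then obtain m where "\<forall>Y\<in>carrier N.Q. (lie_bracket N.Q (N.proj x) ^^ m) Y = \<zero>\<^bsub>N.Q\<^esub>"
    unfolding ad_nilpotent_def by blast
  then show ?thesis
    unfolding N.carrier_quotient N.zero_quotient
    using N.ad_pow_quotient[OF xL] N.coset_eq_J_iff ad_pow_closed[OF xL] by auto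
qed

text \<open>Each term is computed from the previous one alone, so a single repetition makes the
  series constant.\<close>

lemma upper_nilpotent_series_eq_Suc:
  assumes "upper_nilpotent_series F L (Suc i) = upper_nilpotent_series F L i" "i \<le> j"
  shows "upper_nilpotent_series F L j = upper_nilpotent_series F L i"
  using assms(2)
proof (induction j rule: dec_induct)
  case (step j)
  then have "upper_nilpotent_series F L (Suc j) = upper_nilpotent_series F L (Suc i)" by simp
  then show ?case using assms(1) by simp
qed simp

lemma mem_frattini_series:
  assumes "finite_length F L"
  shows "x \<in> frattini_series F L (Suc i) \<longleftrightarrow> x \<in> carrier L \<and>
    (\<forall>M. maximal_lie_subalgebra F L M \<and> upper_nilpotent_series F L i \<subseteq> M \<longrightarrow> x \<in> M)"
proof -
  interpret N: lie_quotient_algebra F L "upper_nilpotent_series F L i"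
    by unfold_locales (rule lie_ideal_upper_nilpotent_series[OF assms(1)])
  show ?thesis unfolding frattini_series_def using N.proj_mem_frattini_iff[of x] by auto
qed

end

section \<open>The Frattini subalgebra and supplements\<close>

context lie_algebra
begin

lemma maximal_lie_subalgebra_restrict_iff:
  assumes "lie_subalgebra F L U"
  shows "maximal_lie_subalgebra F (lie_restrict L U) M \<longleftrightarrow> lie_subalgebra F L M \<and> M \<subset> U \<and>
    (\<forall>K. lie_subalgebra F L K \<and> K \<subseteq> U \<and> M \<subseteq> K \<longrightarrow> K = M \<or> K = U)"
  unfolding maximal_lie_subalgebra_def lie_subalgebra_restrict_iff[OF assms] by auto

lemma maximal_lie_subalgebra_exists:
  assumes "finite_length F L" "lie_subalgebra F L K" "K \<noteq> carrier L"
  obtains M where "maximal_lie_subalgebra F L M" "K \<subseteq> M"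
proof -
  let ?P = "\<lambda>M. lie_subalgebra F L M \<and> K \<subseteq> M \<and> M \<noteq> carrier L"
  show ?thesis
  proof (rule finite_length_maximal[of ?P K, OF assms(1)])
    show "?P K" using assms by blast
    show "submodule M F L" if "?P M" for M using that lie_subalgebra_imp(1) by blast
  next
    fix M assume M: "?P M" and "\<And>V. ?P V \<Longrightarrow> M \<subseteq> V \<Longrightarrow> V = M"
    then have "maximal_lie_subalgebra F L M"
      unfolding maximal_lie_subalgebra_def by blast
    then show thesis using that M by blast
  qed
qed

text \<open>A proper K would lie in a maximal subalgebra, which contains J as well and hence all of
  L. The set J is later the image of a power of ad x.\<close>

lemma frattini_non_generators:
  assumes "finite_length F L" "lie_subalgebra F L K" "J \<subseteq> frattini F L"
    and "carrier L \<subseteq> K <+>\<^bsub>L\<^esub> J"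
  shows "K = carrier L"
proof (rule ccontr)
  assume "K \<noteq> carrier L"
  then obtain M where M: "maximal_lie_subalgebra F L M" "K \<subseteq> M"
    using maximal_lie_subalgebra_exists assms by blast
  then have M': "lie_subalgebra F L M" "M \<noteq> carrier L"
    unfolding maximal_lie_subalgebra_def by auto
  have "J \<subseteq> M" using M assms(3) unfolding frattini_def by blast
  then have "K <+>\<^bsub>L\<^esub> J \<subseteq> M"
    using M(2) by (intro set_add_least lie_subalgebra_imp(1)[OF M'(1)])
  then show False using assms(4) M' lie_subalgebra_imp(2)[OF M'(1)] by blast
qed

section \<open>Fitting's lemma and nilpotency modulo the Frattini subalgebra\<close>

lemma ad_pow_zero_mono:
  assumes "x \<in> carrier L" "(lie_bracket L x ^^ m) y = \<zero>\<^bsub>L\<^esub>" "m \<le> n"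
  shows "(lie_bracket L x ^^ n) y = \<zero>\<^bsub>L\<^esub>"
proof -
  have "(lie_bracket L x ^^ n) y = (lie_bracket L x ^^ (n - m)) ((lie_bracket L x ^^ m) y)"
    using assms(3) funpow_add[of "n - m" m "lie_bracket L x"] by simp
  then show ?thesis using assms ad_pow_linear(3)[OF assms(1)] by simp
qed

text \<open>Induction on m + n instead of the binomial Leibniz formula: one application of ad x
  replaces y by [x, y] or z by [x, z], lowering m or n by one. Coefficients never appear, so the
  characteristic does not matter.\<close>

lemma ad_pow_bracket:
  assumes "x \<in> carrier L" "y \<in> carrier L" "z \<in> carrier L"
    and "(lie_bracket L x ^^ m) y = \<zero>\<^bsub>L\<^esub>" "(lie_bracket L x ^^ n) z = \<zero>\<^bsub>L\<^esub>"
  shows "(lie_bracket L x ^^ (m + n)) (lie_bracket L y z) = \<zero>\<^bsub>L\<^esub>"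
  using assms
proof (induction "m + n" arbitrary: m n y z)
  case 0
  then show ?case by simp
next
  case (Suc k)
  show ?case
  proof (cases "m = 0 \<or> n = 0")
    case True
    then have "lie_bracket L y z = \<zero>\<^bsub>L\<^esub>" using Suc.prems by auto
    then show ?thesis using ad_pow_linear(3)[OF assms(1)] by simp
  next
    case False
    then obtain m' n' where mn: "m = Suc m'" "n = Suc n'" by (meson not0_implies_Suc)
    let ?d = "lie_bracket L x"
    have "(?d ^^ (m' + n)) (lie_bracket L (?d y) z) = \<zero>\<^bsub>L\<^esub>"
      using Suc mn by (intro Suc.hyps(1)) (auto simp: lie_closed funpow_swap1)
    moreover have "(?d ^^ (m + n')) (lie_bracket L y (?d z)) = \<zero>\<^bsub>L\<^esub>"
      using Suc mn by (intro Suc.hyps(1)) (auto simp: lie_closed funpow_swap1)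
    moreover have "m' + n = k" "m + n' = k" using Suc.hyps(2) mn by auto
    moreover have "(?d ^^ Suc k) (lie_bracket L y z) =
        (?d ^^ k) (lie_bracket L (?d y) z) \<oplus>\<^bsub>L\<^esub> (?d ^^ k) (lie_bracket L y (?d z))"
      using Suc.prems(1-3) lie_leibniz[of x y z] ad_pow_linear(1)[OF assms(1)]
      by (simp add: funpow_swap1 lie_closed)
    ultimately show ?thesis using Suc.hyps(2) by simp
  qed
qed

lemma lie_subalgebra_Fitting_null:
  assumes x: "x \<in> carrier L"
  shows "lie_subalgebra F L {y \<in> carrier L. \<exists>m. (lie_bracket L x ^^ m) y = \<zero>\<^bsub>L\<^esub>}"
    (is "lie_subalgebra F L ?E")
proof -
  have "y \<oplus>\<^bsub>L\<^esub> z \<in> ?E" if yz: "y \<in> ?E" "z \<in> ?E" for y z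
  proof -
    obtain m n where "(lie_bracket L x ^^ m) y = \<zero>\<^bsub>L\<^esub>" "(lie_bracket L x ^^ n) z = \<zero>\<^bsub>L\<^esub>"
      using yz by blast
    then have "(lie_bracket L x ^^ (m + n)) (y \<oplus>\<^bsub>L\<^esub> z) = \<zero>\<^bsub>L\<^esub>"
      using ad_pow_zero_mono[OF x, of m y "m + n"] ad_pow_zero_mono[OF x, of n z "m + n"]
        ad_pow_linear(1)[OF x, of y z] yz by simp
    then show ?thesis using yz by auto
  qed
  moreover have "a \<odot>\<^bsub>L\<^esub> y \<in> ?E" if ay: "a \<in> carrier F" "y \<in> ?E" for a y
  proof -
    obtain m where "(lie_bracket L x ^^ m) y = \<zero>\<^bsub>L\<^esub>" using ay(2) by blast
    then have "(lie_bracket L x ^^ m) (a \<odot>\<^bsub>L\<^esub> y) = \<zero>\<^bsub>L\<^esub>"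
      using ad_pow_linear(2)[OF x, of a y] ay by simp
    then show ?thesis using ay by auto
  qed
  moreover have "\<zero>\<^bsub>L\<^esub> \<in> ?E" using ad_pow_linear(3)[OF x] by auto
  moreover have "lie_bracket L y z \<in> ?E" if "y \<in> ?E" "z \<in> ?E" for y z
    using that ad_pow_bracket[OF x] lie_closed by blast
  ultimately show ?thesis
    unfolding lie_subalgebra_def submodule_iff by blast
qed

text \<open>Fitting's lemma writes \<open>L\<close> as the null component of \<open>ad x\<close>, a subalgebra, plus the image of a
  high power of \<open>ad x\<close>, which consists of non-generators.\<close>

lemma ad_nilpotent_mod_frattini:
  assumes fin: "finite_length F L" and x: "x \<in> carrier L"
    and k0: "\<And>y. y \<in> carrier L \<Longrightarrow> (lie_bracket L x ^^ k0) y \<in> frattini F L"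
  shows "ad_nilpotent L x"
proof -
  let ?d = "lie_bracket L x"
  define E where "E = {y \<in> carrier L. \<exists>m. (?d ^^ m) y = \<zero>\<^bsub>L\<^esub>}"
  let ?P = "\<lambda>H. \<exists>k\<ge>k0. H = (?d ^^ k) ` carrier L"
  have "?P ((?d ^^ k0) ` carrier L)" by blast
  moreover have "submodule H F L" if "?P H" for H using that submodule_ad_pow_image[OF x] by blast
  ultimately obtain H where "?P H" and min: "\<And>K. ?P K \<Longrightarrow> K \<subseteq> H \<Longrightarrow> K = H"
    using finite_length_minimal[of ?P "(?d ^^ k0) ` carrier L", OF fin] by blast
  then obtain k where k: "k0 \<le> k" and H: "H = (?d ^^ k) ` carrier L" by blast
  have Hphi: "H \<subseteq> frattini F L"
  proof
    fix u assume "u \<in> H"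
    then obtain y where y: "y \<in> carrier L" "u = (?d ^^ k) y" using H by blast
    then have "u = (?d ^^ k0) ((?d ^^ (k - k0)) y)"
      using k funpow_add[of k0 "k - k0" ?d] by simp
    then show "u \<in> frattini F L" using k0 ad_pow_closed[OF x y(1)] by simp
  qed
  \<comment> \<open>By minimality the image no longer shrinks, so for each y some w in H has the
    same image as y under the k-th power of ad x. Then y - w is in the null component E.\<close>
  have "(?d ^^ (k + k)) ` carrier L = H"
  proof (rule min)
    show "?P ((?d ^^ (k + k)) ` carrier L)" using k trans_le_add1 by blast
    show "(?d ^^ (k + k)) ` carrier L \<subseteq> H" using ad_pow_closed[OF x] by (auto simp: H funpow_add)
  qed
  then have stable: "\<exists>z\<in>carrier L. (?d ^^ k) y = (?d ^^ k) ((?d ^^ k) z)" if "y \<in> carrier L" for y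
    using that unfolding H by (auto simp: funpow_add)
  have "carrier L \<subseteq> E <+>\<^bsub>L\<^esub> H"
  proof
    fix y assume y: "y \<in> carrier L"
    then obtain z where z: "z \<in> carrier L" "(?d ^^ k) y = (?d ^^ k) ((?d ^^ k) z)"
      using stable by blast
    define w where "w = (?d ^^ k) z"
    have w: "w \<in> carrier L" "w \<in> H" using z ad_pow_closed[OF x] H w_def by auto
    define e where "e = y \<ominus>\<^bsub>L\<^esub> w"
    have e: "e \<in> carrier L" "y = e \<oplus>\<^bsub>L\<^esub> w"
      using y w by (auto simp: e_def a_minus_def M.a_assoc M.l_neg)
    have "(?d ^^ k) e \<oplus>\<^bsub>L\<^esub> (?d ^^ k) w = (?d ^^ k) w"
      using ad_pow_linear(1)[OF x e(1) w(1), of k] e(2) z(2) w_def by simp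
    then have "(?d ^^ k) e = \<zero>\<^bsub>L\<^esub>"
      using ad_pow_closed[OF x] e(1) w(1) M.add.r_cancel_one by metis
    then have "e \<in> E" using e(1) unfolding E_def by blast
    then show "y \<in> E <+>\<^bsub>L\<^esub> H" using e(2) w(2) unfolding mem_set_add by blast
  qed
  then have E: "E = carrier L"
    using frattini_non_generators[OF fin _ Hphi] lie_subalgebra_Fitting_null[OF x] unfolding E_def by blast
  \<comment> \<open>E = L yields an exponent for each y separately, whereas
    \<open>ad_nilpotent\<close> asks for one exponent for all. The kernels of the powers increase,
    and a maximal one supplies it.\<close>
  let ?R = "\<lambda>K. \<exists>m. K = {y \<in> carrier L. (?d ^^ m) y \<in> {\<zero>\<^bsub>L\<^esub>}}"
  have "?R {y \<in> carrier L. (?d ^^ 0) y \<in> {\<zero>\<^bsub>L\<^esub>}}" by blast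
  moreover have "submodule K F L" if "?R K" for K
    using that submodule_ad_pow_vimage[OF x submodule_zero] by blast
  ultimately obtain K where "?R K" and max: "\<And>V. ?R V \<Longrightarrow> K \<subseteq> V \<Longrightarrow> V = K"
    using finite_length_maximal[of ?R "{y \<in> carrier L. (?d ^^ 0) y \<in> {\<zero>\<^bsub>L\<^esub>}}", OF fin] by blast
  then obtain m where K: "K = {y \<in> carrier L. (?d ^^ m) y \<in> {\<zero>\<^bsub>L\<^esub>}}" by blast
  have "(?d ^^ m) y = \<zero>\<^bsub>L\<^esub>" if y: "y \<in> carrier L" for y
  proof -
    obtain n where n: "(?d ^^ n) y = \<zero>\<^bsub>L\<^esub>" using y E unfolding E_def by blast
    let ?V = "{y \<in> carrier L. (?d ^^ (m + n)) y \<in> {\<zero>\<^bsub>L\<^esub>}}"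
    have "K \<subseteq> ?V" using ad_pow_zero_mono[OF x, of m _ "m + n"] unfolding K by auto
    then have "?V = K" using max by blast
    moreover have "y \<in> ?V" using y ad_pow_zero_mono[OF x n, of "m + n"] by simp
    ultimately show ?thesis unfolding K by blast
  qed
  then show ?thesis unfolding ad_nilpotent_def by blast
qed

theorem lie_nilpotent_mod_frattini:
  assumes fin: "finite_length F L" and A: "lie_subalgebra F L A"
    and "\<And>x. x \<in> A \<Longrightarrow> \<exists>k. \<forall>y\<in>carrier L. (lie_bracket L x ^^ k) y \<in> frattini F L"
  shows "lie_nilpotent F (lie_restrict L A)"
proof -
  have "ad_nilpotent L x" if "x \<in> A" for x
    using ad_nilpotent_mod_frattini[OF fin] assms(3)[OF that] that lie_subalgebra_imp(2)[OF A] by blast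
  then show ?thesis
    using Engel[OF fin A] lie_nilpotent_restrictI[OF A] by blast
qed

text \<open>For M maximal in U, the subalgebra U \<inter> (I + M) lies between M and U. If it were
  U, then M would be a smaller supplement of I; so it is M, which therefore contains I \<inter>
  U.\<close>

lemma minimal_supplement:
  assumes fin: "finite_length F L" and I: "lie_ideal F L I"
  obtains U where "lie_subalgebra F L U" "carrier L = I <+>\<^bsub>L\<^esub> U"
    "I \<inter> U \<subseteq> frattini F (lie_restrict L U)"
proof -
  note I' = lie_ideal_imp[OF I]
  let ?P = "\<lambda>U. lie_subalgebra F L U \<and> carrier L \<subseteq> I <+>\<^bsub>L\<^esub> U"
  have "?P (carrier L)"
    using lie_subalgebra_carrier subset_set_add(2)[OF I'(1) carrier_is_submodule] by blast
  moreover have "submodule U F L" if "?P U" for U using that lie_subalgebra_imp(1) by blast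
  ultimately obtain U where U: "?P U" and min: "\<And>V. ?P V \<Longrightarrow> V \<subseteq> U \<Longrightarrow> V = U"
    using finite_length_minimal[of ?P "carrier L", OF fin] by blast
  note U' = lie_subalgebra_imp[of U]
  have "I \<inter> U \<subseteq> M" if "maximal_lie_subalgebra F (lie_restrict L U) M" for M
  proof -
    have M: "lie_subalgebra F L M" "M \<subset> U"
      and max: "\<And>K. lie_subalgebra F L K \<Longrightarrow> K \<subseteq> U \<Longrightarrow> M \<subseteq> K \<Longrightarrow> K = M \<or> K = U"
      using that U by (auto simp: maximal_lie_subalgebra_restrict_iff)
    note M' = lie_subalgebra_imp[OF M(1)]
    have IM: "lie_subalgebra F L (I <+>\<^bsub>L\<^esub> M)" using I M(1) by (rule lie_subalgebra_ideal_add)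
    note sub = subset_set_add[OF I'(1) M'(1)]
    have "\<not> U \<subseteq> I <+>\<^bsub>L\<^esub> M"
    proof
      assume "U \<subseteq> I <+>\<^bsub>L\<^esub> M"
      then have "I <+>\<^bsub>L\<^esub> U \<subseteq> I <+>\<^bsub>L\<^esub> M"
        using sub by (intro set_add_least lie_subalgebra_imp(1)[OF IM])
      then show False using min[of M] U M by blast
    qed
    moreover have "U \<inter> (I <+>\<^bsub>L\<^esub> M) = M \<or> U \<inter> (I <+>\<^bsub>L\<^esub> M) = U"
      using U M(2) sub by (intro max lie_subalgebra_Int IM) auto
    ultimately show ?thesis using sub(1) by blast
  qed
  then have "I \<inter> U \<subseteq> frattini F (lie_restrict L U)"
    unfolding frattini_def by auto
  moreover have "carrier L = I <+>\<^bsub>L\<^esub> U"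
    using U set_add_least[OF carrier_is_submodule I'(2)] U'(2) by blast
  ultimately show ?thesis using that U by blast
qed

text \<open>The lattice form of the second isomorphism theorem: K \<mapsto> N + K and K \<mapsto> K
  \<inter> U are inverse bijections between subalgebras of U above N \<inter> U and subalgebras of L
  above N, so maximal ones correspond.\<close>

lemma frattini_restrict_supplement:
  assumes N: "lie_ideal F L N" and U: "lie_subalgebra F L U" and L: "carrier L = N <+>\<^bsub>L\<^esub> U"
    and NU: "N \<inter> U \<subseteq> frattini F (lie_restrict L U)"
  shows "frattini F (lie_restrict L U) =
    {x \<in> U. \<forall>M. maximal_lie_subalgebra F L M \<and> N \<subseteq> M \<longrightarrow> x \<in> M}"
proof -
  note N' = lie_ideal_imp[OF N] and U' = lie_subalgebra_imp[OF U]
  have frat: "frattini F (lie_restrict L U) =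
      U \<inter> \<Inter>{M. maximal_lie_subalgebra F (lie_restrict L U) M}"
    unfolding frattini_def by simp
  \<comment> \<open>\<open>modular\<close> and \<open>trace\<close> are the two inverse laws of this
    correspondence, each an instance of the Dedekind law.\<close>
  have modular: "K = (K \<inter> U) <+>\<^bsub>L\<^esub> N" if "lie_subalgebra F L K" "N \<subseteq> K" for K
  proof -
    have "K = K \<inter> (U <+>\<^bsub>L\<^esub> N)"
      using L lie_subalgebra_imp(2)[OF that(1)] set_add_commute[OF N'(2) U'(2)] by auto
    also have "\<dots> = (K \<inter> U) <+>\<^bsub>L\<^esub> N"
      using that by (intro Dedekind_law U' N' lie_subalgebra_imp(1)) auto
    finally show ?thesis .
  qed
  have trace: "U \<inter> (N <+>\<^bsub>L\<^esub> K) = K" if "lie_subalgebra F L K" "K \<subseteq> U" "N \<inter> U \<subseteq> K" for K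
  proof -
    have K: "submodule K F L" using lie_subalgebra_imp(1)[OF that(1)] .
    have "U \<inter> (N <+>\<^bsub>L\<^esub> K) = (U \<inter> N) <+>\<^bsub>L\<^esub> K"
      using that by (intro Dedekind_law U' N' K) auto
    also have "\<dots> = K"
      using set_add_least[OF K _ order_refl, of "U \<inter> N"] that(3)
        subset_set_add(2)[OF submodule_Int[OF U'(1) N'(1)] K] by auto
    finally show ?thesis .
  qed
  have down: "maximal_lie_subalgebra F (lie_restrict L U) (M \<inter> U)"
    if M: "maximal_lie_subalgebra F L M" "N \<subseteq> M" for M
    unfolding maximal_lie_subalgebra_restrict_iff[OF U]
  proof (intro conjI allI impI)
    have M': "lie_subalgebra F L M" "M \<noteq> carrier L"
      and max: "\<And>K. lie_subalgebra F L K \<Longrightarrow> M \<subseteq> K \<Longrightarrow> K = M \<or> K = carrier L"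
      using M unfolding maximal_lie_subalgebra_def by auto
    show "lie_subalgebra F L (M \<inter> U)" using M'(1) U by (rule lie_subalgebra_Int)
    have "\<not> U \<subseteq> M"
      using set_add_least[OF lie_subalgebra_imp(1)[OF M'(1)] M(2)] M'(2)
        lie_subalgebra_imp(2)[OF M'(1)] L by blast
    then show "M \<inter> U \<subset> U" by blast
    fix K assume "lie_subalgebra F L K \<and> K \<subseteq> U \<and> M \<inter> U \<subseteq> K"
    then have K: "lie_subalgebra F L K" "K \<subseteq> U" "M \<inter> U \<subseteq> K" by auto
    have NK: "lie_subalgebra F L (N <+>\<^bsub>L\<^esub> K)" using N K(1) by (rule lie_subalgebra_ideal_add)
    note sub = subset_set_add[OF N'(1) lie_subalgebra_imp(1)[OF K(1)]]
    have "M \<subseteq> N <+>\<^bsub>L\<^esub> K"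
      using modular[OF M'(1) M(2)] set_add_least[OF lie_subalgebra_imp(1)[OF NK], of "M \<inter> U" N] K(3) sub
      by blast
    then have "N <+>\<^bsub>L\<^esub> K = M \<or> N <+>\<^bsub>L\<^esub> K = carrier L" using max[OF NK] by blast
    moreover have "U \<inter> (N <+>\<^bsub>L\<^esub> K) = K" using K M(2) by (intro trace) auto
    ultimately show "K = M \<inter> U \<or> K = U" using U'(2) by blast
  qed
  have up: "maximal_lie_subalgebra F L (N <+>\<^bsub>L\<^esub> M)"
    if M: "maximal_lie_subalgebra F (lie_restrict L U) M" for M
  proof -
    have M': "lie_subalgebra F L M" "M \<subset> U"
      and max: "\<And>K. lie_subalgebra F L K \<Longrightarrow> K \<subseteq> U \<Longrightarrow> M \<subseteq> K \<Longrightarrow> K = M \<or> K = U"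
      using M unfolding maximal_lie_subalgebra_restrict_iff[OF U] by auto
    \<comment> \<open>Here \<open>NU\<close> enters: every maximal subalgebra of U contains N
      \<inter> U, so none of them is missed by the correspondence.\<close>
    have NM: "N \<inter> U \<subseteq> M" using M NU unfolding frat by blast
    note sub = subset_set_add[OF N'(1) lie_subalgebra_imp(1)[OF M'(1)]]
    have tr: "U \<inter> (N <+>\<^bsub>L\<^esub> M) = M" using M' NM by (intro trace) auto
    show ?thesis
      unfolding maximal_lie_subalgebra_def
    proof (intro conjI allI impI)
      show "lie_subalgebra F L (N <+>\<^bsub>L\<^esub> M)" using N M'(1) by (rule lie_subalgebra_ideal_add)
      show "N <+>\<^bsub>L\<^esub> M \<noteq> carrier L" using tr M'(2) U'(2) by blast
      fix K assume "lie_subalgebra F L K \<and> N <+>\<^bsub>L\<^esub> M \<subseteq> K"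
      then have K: "lie_subalgebra F L K" "N <+>\<^bsub>L\<^esub> M \<subseteq> K" by auto
      have "K \<inter> U = M \<or> K \<inter> U = U"
        using K sub M'(2) by (intro max lie_subalgebra_Int U) auto
      moreover have "K = (K \<inter> U) <+>\<^bsub>L\<^esub> N" using K sub by (intro modular) auto
      ultimately show "K = N <+>\<^bsub>L\<^esub> M \<or> K = carrier L"
        using L set_add_commute[OF N'(2) U'(2)] set_add_commute[OF N'(2) lie_subalgebra_imp(2)[OF M'(1)]]
        by auto
    qed
  qed
  show ?thesis
  proof (intro equalityI subsetI)
    fix x assume "x \<in> frattini F (lie_restrict L U)"
    then show "x \<in> {x \<in> U. \<forall>M. maximal_lie_subalgebra F L M \<and> N \<subseteq> M \<longrightarrow> x \<in> M}"
      using down unfolding frat by blast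
  next
    fix x assume x: "x \<in> {x \<in> U. \<forall>M. maximal_lie_subalgebra F L M \<and> N \<subseteq> M \<longrightarrow> x \<in> M}"
    have "x \<in> M" if M: "maximal_lie_subalgebra F (lie_restrict L U) M" for M
    proof -
      have M': "lie_subalgebra F L M" "M \<subset> U"
        using M unfolding maximal_lie_subalgebra_restrict_iff[OF U] by auto
      have "x \<in> N <+>\<^bsub>L\<^esub> M"
        using x up[OF M] subset_set_add(1)[OF N'(1) lie_subalgebra_imp(1)[OF M'(1)]] by blast
      moreover have "U \<inter> (N <+>\<^bsub>L\<^esub> M) = M"
        using M' M NU unfolding frat by (intro trace) auto
      ultimately show "x \<in> M" using x by blast
    qed
    then show "x \<in> frattini F (lie_restrict L U)" using x unfolding frat by blast
  qed
qed

end

section \<open>Nilpotent decompositions\<close>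

context lie_algebra
begin

text \<open>The invariant of the chain. It speaks of N_i and L only, not of the preceding member of
  the chain, which is the form needed for comparing with L/N_i.\<close>

definition frattini_supplement :: "nat \<Rightarrow> 'b set \<Rightarrow> bool" where
  "frattini_supplement i U \<longleftrightarrow> lie_subalgebra F L U \<and>
     carrier L = upper_nilpotent_series F L i <+>\<^bsub>L\<^esub> U \<and>
     upper_nilpotent_series F L i \<inter> U \<subseteq> frattini F (lie_restrict L U)"

lemma frattini_supplement_0: "frattini_supplement 0 (carrier L)"
proof -
  have "carrier L = {\<zero>\<^bsub>L\<^esub>} <+>\<^bsub>L\<^esub> carrier L"
    by (intro equalityI subset_set_add set_add_least submodule_zero carrier_is_submodule) auto
  moreover have "\<zero>\<^bsub>L\<^esub> \<in> frattini F L"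
    unfolding frattini_def maximal_lie_subalgebra_def
    using submodule_imp(2) lie_subalgebra_imp(1) by blast
  ultimately show ?thesis
    unfolding frattini_supplement_def using lie_subalgebra_carrier by simp
qed

text \<open>A minimal supplement of N_{i+1} \<inter> U is taken inside U. It supplements N_{i+1} in
  L as well, because N_i and U are both contained in N_{i+1} + V.\<close>

lemma frattini_supplement_Suc:
  assumes fin: "finite_length F L" and "frattini_supplement i U"
  shows "\<exists>V. frattini_supplement (Suc i) V \<and> V \<subseteq> U \<and>
    U = (upper_nilpotent_series F L (Suc i) \<inter> U) <+>\<^bsub>L\<^esub> V"
proof -
  let ?N = "upper_nilpotent_series F L"
  have U: "lie_subalgebra F L U" and LU: "carrier L = ?N i <+>\<^bsub>L\<^esub> U"
    using assms(2) unfolding frattini_supplement_def by auto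
  note U' = lie_subalgebra_imp[OF U] and N = lie_ideal_imp[OF lie_ideal_upper_nilpotent_series[OF fin]]
  interpret U: lie_algebra F "lie_restrict L U" using U by (rule lie_algebra_restrict)
  have "lie_ideal F (lie_restrict L U) (?N (Suc i) \<inter> U)"
    unfolding lie_ideal_def submodule_restrict_iff[OF U'(1)]
    using submodule_Int[OF N(1) U'(1)] N(3) U'(2,3) by (auto simp del: upper_nilpotent_series.simps)
  then obtain V where V: "lie_subalgebra F (lie_restrict L U) V"
    "carrier (lie_restrict L U) = (?N (Suc i) \<inter> U) <+>\<^bsub>lie_restrict L U\<^esub> V"
    "?N (Suc i) \<inter> U \<inter> V \<subseteq> frattini F (lie_restrict (lie_restrict L U) V)"
    using U.minimal_supplement[OF finite_length_restrict[OF fin U'(1)]] by blast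
  have VU: "lie_subalgebra F L V" "V \<subseteq> U"
    using V(1) unfolding lie_subalgebra_restrict_iff[OF U] by auto
  have UV: "U = (?N (Suc i) \<inter> U) <+>\<^bsub>L\<^esub> V"
    using V(2) by (simp add: set_add_def' del: upper_nilpotent_series.simps)
  have sub: "submodule (?N (Suc i) <+>\<^bsub>L\<^esub> V) F L"
    using N(1) lie_subalgebra_imp(1)[OF VU(1)] by (rule submodule_set_add)
  have "?N (Suc i) \<inter> U <+>\<^bsub>L\<^esub> V \<subseteq> ?N (Suc i) <+>\<^bsub>L\<^esub> V"
    by (intro set_add_mono) auto
  then have "U \<subseteq> ?N (Suc i) <+>\<^bsub>L\<^esub> V" using UV by blast
  moreover have "?N i \<subseteq> ?N (Suc i) <+>\<^bsub>L\<^esub> V"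
    using upper_nilpotent_series_Suc_subset[OF fin] subset_set_add(1)[OF N(1) lie_subalgebra_imp(1)[OF VU(1)]]
    by blast
  ultimately have "carrier L = ?N (Suc i) <+>\<^bsub>L\<^esub> V"
    unfolding LU using set_add_least[OF sub] LU submodule_imp(1)[OF sub] by blast
  moreover have "?N (Suc i) \<inter> V \<subseteq> frattini F (lie_restrict L V)"
    using V(3) VU(2) by (simp add: Int_assoc Int_absorb1 del: upper_nilpotent_series.simps)
  ultimately show ?thesis
    unfolding frattini_supplement_def using VU UV by blast
qed

text \<open>For x in N_{i+1} \<inter> U a power of ad x maps L into N_i. Since U is closed under
  brackets, it maps U into N_i \<inter> U, which is part of phi(U); the Frattini criterion for
  nilpotency is then applied inside U.\<close>

lemma nilpotent_series_Int_supplement: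
  assumes fin: "finite_length F L" and "frattini_supplement i U"
  shows "lie_subalgebra F L (upper_nilpotent_series F L (Suc i) \<inter> U)"
    and "lie_nilpotent F (lie_restrict L (upper_nilpotent_series F L (Suc i) \<inter> U))"
    and "upper_nilpotent_series F L (Suc i) =
      upper_nilpotent_series F L i <+>\<^bsub>L\<^esub> (upper_nilpotent_series F L (Suc i) \<inter> U)"
proof -
  let ?N = "upper_nilpotent_series F L"
  let ?LU = "lie_restrict L U"
  have U: "lie_subalgebra F L U" and LU: "carrier L = ?N i <+>\<^bsub>L\<^esub> U"
    and frat: "?N i \<inter> U \<subseteq> frattini F ?LU"
    using assms(2) unfolding frattini_supplement_def by auto
  note U' = lie_subalgebra_imp[OF U] and N = lie_ideal_imp[OF lie_ideal_upper_nilpotent_series[OF fin]]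
  interpret U: lie_algebra F ?LU using U by (rule lie_algebra_restrict)
  show sub: "lie_subalgebra F L (?N (Suc i) \<inter> U)"
    by (intro lie_subalgebra_Int U lie_ideal_imp_subalgebra lie_ideal_upper_nilpotent_series fin)
  have "lie_nilpotent F (lie_restrict ?LU (?N (Suc i) \<inter> U))"
  proof (rule U.lie_nilpotent_mod_frattini[OF finite_length_restrict[OF fin U'(1)]])
    show "lie_subalgebra F ?LU (?N (Suc i) \<inter> U)"
      unfolding lie_subalgebra_restrict_iff[OF U] using sub by blast
    fix x assume x: "x \<in> ?N (Suc i) \<inter> U"
    then obtain k where "\<forall>y\<in>carrier L. (lie_bracket L x ^^ k) y \<in> ?N i"
      using upper_nilpotent_series_ad[OF fin] by blast
    moreover have "(lie_bracket L x ^^ k) y \<in> U" if "y \<in> U" for y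
      using U.ad_pow_closed[of x y k] x that by simp
    ultimately have "\<forall>y\<in>carrier ?LU. (lie_bracket ?LU x ^^ k) y \<in> frattini F ?LU"
      using frat U'(2) by auto
    then show "\<exists>k. \<forall>y\<in>carrier ?LU. (lie_bracket ?LU x ^^ k) y \<in> frattini F ?LU" by blast
  qed
  then show "lie_nilpotent F (lie_restrict L (?N (Suc i) \<inter> U))" by simp
  have "?N (Suc i) = ?N (Suc i) \<inter> (U <+>\<^bsub>L\<^esub> ?N i)"
    using LU set_add_commute[OF N(2) U'(2)] N(2)[of "Suc i"] by (auto simp del: upper_nilpotent_series.simps)
  also have "\<dots> = (?N (Suc i) \<inter> U) <+>\<^bsub>L\<^esub> ?N i"
    by (intro Dedekind_law N U' upper_nilpotent_series_Suc_subset[OF fin])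
  also have "\<dots> = ?N i <+>\<^bsub>L\<^esub> (?N (Suc i) \<inter> U)"
    using U'(2) N(2) by (intro set_add_commute) auto
  finally show "?N (Suc i) = ?N i <+>\<^bsub>L\<^esub> (?N (Suc i) \<inter> U)" .
qed

text \<open>The chosen supplements disappear from the statement: they are recovered as the tail sums
  of the family B.\<close>

lemma nilpotent_decomposition:
  assumes fin: "finite_length F L" and n: "n \<ge> 1"
    and Nn: "upper_nilpotent_series F L n = carrier L"
    and Nn1: "upper_nilpotent_series F L (n - 1) \<noteq> carrier L"
  obtains B where
    "\<And>i. i \<in> {1..n} \<Longrightarrow> lie_subalgebra F L (B i)"
    "\<And>i. i \<in> {1..n} \<Longrightarrow> lie_nilpotent F (lie_restrict L (B i))"
    "\<And>i. i \<in> {1..n} \<Longrightarrow> B i \<noteq> {\<zero>\<^bsub>L\<^esub>}"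
    "\<And>i. upper_nilpotent_series F L i = subspace_sum L {1..i} B"
    "\<And>i j. 1 \<le> i \<Longrightarrow> i \<le> j \<Longrightarrow> lie_product F L (B i) (B j) \<subseteq> B i"
    "\<And>i. i < n \<Longrightarrow> frattini_supplement i (subspace_sum L {i + 1..n} B)"
proof -
  let ?N = "upper_nilpotent_series F L"
  note N = lie_ideal_imp[OF lie_ideal_upper_nilpotent_series[OF fin]]
  \<comment> \<open>Dependent choice, because each supplement is taken inside the one chosen before
    it.\<close>
  have "\<exists>U. \<forall>i. frattini_supplement i (U i) \<and>
      (U (Suc i) \<subseteq> U i \<and> U i = (?N (Suc i) \<inter> U i) <+>\<^bsub>L\<^esub> U (Suc i))"
  proof (rule dependent_nat_choice)
    show "\<exists>U. frattini_supplement 0 U" using frattini_supplement_0 by blast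
    show "\<exists>V. frattini_supplement (Suc i) V \<and> (V \<subseteq> U \<and> U = (?N (Suc i) \<inter> U) <+>\<^bsub>L\<^esub> V)"
      if "frattini_supplement i U" for U i
      using fin that by (rule frattini_supplement_Suc)
  qed
  then obtain U where U: "\<forall>i. frattini_supplement i (U i) \<and>
      (U (Suc i) \<subseteq> U i \<and> U i = (?N (Suc i) \<inter> U i) <+>\<^bsub>L\<^esub> U (Suc i))" by (elim exE)
  then have supp: "frattini_supplement i (U i)" for i by (elim allE conjE)
  from U have U_Suc: "U (Suc i) \<subseteq> U i" for i by (elim allE conjE)
  from U have U_split: "U i = (?N (Suc i) \<inter> U i) <+>\<^bsub>L\<^esub> U (Suc i)" for i by (elim allE conjE)
  have U: "lie_subalgebra F L (U i)" for i
    using supp[of i] unfolding frattini_supplement_def by (rule conjunct1)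
  have U_mono: "U j \<subseteq> U i" if "i \<le> j" for i j
    using U_Suc that by (rule lift_Suc_antimono_le)
  \<comment> \<open>The shift matches B_i with U_{i-1}; at i = 0 the truncated subtraction merely
    gives B 0 = 0.\<close>
  define B where "B i = ?N i \<inter> U (i - 1)" for i
  have B_Suc: "B (Suc i) = ?N (Suc i) \<inter> U i" for i unfolding B_def by simp
  have B_sub: "lie_subalgebra F L (B i)" for i
    unfolding B_def
    by (intro lie_subalgebra_Int U lie_ideal_imp_subalgebra lie_ideal_upper_nilpotent_series fin)
  note B = lie_subalgebra_imp[OF B_sub]
  have N_Suc: "?N (Suc i) = ?N i <+>\<^bsub>L\<^esub> B (Suc i)" for i
    unfolding B_Suc using fin supp by (rule nilpotent_series_Int_supplement(3))
  have N_sum: "?N i = subspace_sum L {1..i} B" for i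
  proof (induction i)
    case 0
    show ?case using subspace_sum_empty[of B] by simp
  next
    case (Suc i)
    show ?case
      unfolding N_Suc Suc by (rule subspace_sum_atMost_Suc[symmetric]) (rule B(2))
  qed
  \<comment> \<open>Downward induction from i = n - 1, where U_{n-1} = N_n \<inter> U_{n-1} = B_n
    because N_n = L; below that, U_i = B_{i+1} + U_{i+1}.\<close>
  have U_sum: "subspace_sum L {i + 1..n} B = U i" if "i < n" for i
    using that
  proof (induction "n - i" arbitrary: i)
    case 0
    then show ?case by simp
  next
    case (Suc k)
    show ?case
    proof (cases "Suc i = n")
      case True
      then have "subspace_sum L {i + 1..n} B = B n"
        using subspace_sum_singleton[of B n] B(2) by simp
      also have "\<dots> = U i"
        using Nn lie_subalgebra_imp(2)[OF U, of i] True B_Suc[of i]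
        by (simp add: Int_absorb1 del: upper_nilpotent_series.simps)
      finally show ?thesis .
    next
      case False
      then have "Suc i < n" using Suc by simp
      then have IH: "subspace_sum L {Suc i + 1..n} B = U (Suc i)" using Suc by simp
      have "{i + 1..n} = insert (Suc i) {Suc i + 1..n}" using Suc.prems by auto
      then have "subspace_sum L {i + 1..n} B = B (Suc i) <+>\<^bsub>L\<^esub> subspace_sum L {Suc i + 1..n} B"
        using subspace_sum_insert[of "{Suc i + 1..n}" "Suc i" B] B(2) by simp
      then show ?thesis unfolding IH B_Suc using U_split[of i] by (rule trans[OF _ sym])
    qed
  qed
  show thesis
  proof (rule that)
    fix i assume "i \<in> {1..n}"
    then obtain k where k: "i = Suc k" "k < n" by (cases i) auto
    show "lie_subalgebra F L (B i)" by (rule B_sub)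
    show "lie_nilpotent F (lie_restrict L (B i))"
      unfolding k(1) B_Suc using fin supp by (rule nilpotent_series_Int_supplement(2))
    \<comment> \<open>A zero summand would make two consecutive terms equal, so the series would
      stop there and give N_{n-1} = N_n = L.\<close>
    show "B i \<noteq> {\<zero>\<^bsub>L\<^esub>}"
    proof
      assume "B i = {\<zero>\<^bsub>L\<^esub>}"
      then have "?N (Suc k) = ?N k <+>\<^bsub>L\<^esub> {\<zero>\<^bsub>L\<^esub>}" using N_Suc[of k] k(1) by metis
      also have "\<dots> \<subseteq> ?N k"
        using submodule_imp(2)[OF N(1)] by (intro set_add_least N(1)) auto
      finally have "?N (Suc k) \<subseteq> ?N k" .
      then have eq: "?N (Suc k) = ?N k" using upper_nilpotent_series_Suc_subset[OF fin] by blast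
      have "?N (n - 1) = ?N k" "?N n = ?N k"
        using k(2) by (intro upper_nilpotent_series_eq_Suc[OF eq]; simp)+
      then show False using Nn Nn1 by simp
    qed
  next
    fix i show "?N i = subspace_sum L {1..i} B" by (rule N_sum)
  next
    fix i j :: nat assume ij: "1 \<le> i" "i \<le> j"
    \<comment> \<open>Both factors of [B_i, B_j] now lie in the subalgebra U_{i-1}, and the first
      lies in the ideal N_i.\<close>
    have "U (j - 1) \<subseteq> U (i - 1)" using ij by (intro U_mono) simp
    then show "lie_product F L (B i) (B j) \<subseteq> B i"
      unfolding B_def using N(2,4) lie_subalgebra_imp(3)[OF U]
      by (intro lie_product_least B(1)[unfolded B_def]) blast
  next
    fix i assume "i < n"
    then show "frattini_supplement i (subspace_sum L {i + 1..n} B)"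
      using U_sum supp by simp
  qed
qed

section \<open>Condition (iv), the nilpotent length and the equivalence\<close>

lemma frattini_supplement_frattini_series:
  assumes fin: "finite_length F L" and "frattini_supplement i U"
  shows "upper_nilpotent_series F L i \<inter> U \<subseteq> frattini F (lie_restrict L U)"
    and "frattini F (lie_restrict L U) = frattini_series F L (i + 1) \<inter> U"
proof -
  have U: "lie_subalgebra F L U" "carrier L = upper_nilpotent_series F L i <+>\<^bsub>L\<^esub> U"
    and NU: "upper_nilpotent_series F L i \<inter> U \<subseteq> frattini F (lie_restrict L U)"
    using assms(2) unfolding frattini_supplement_def by auto
  show "upper_nilpotent_series F L i \<inter> U \<subseteq> frattini F (lie_restrict L U)" by (rule NU)
  show "frattini F (lie_restrict L U) = frattini_series F L (i + 1) \<inter> U"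
    using frattini_restrict_supplement[OF lie_ideal_upper_nilpotent_series[OF fin] U NU]
      mem_frattini_series[OF fin, of _ i] lie_subalgebra_imp(2)[OF U(1)] by auto
qed

text \<open>The zero subalgebra is proper in B, hence contained in a maximal subalgebra, and the
  Frattini subalgebra is contained in that one too.\<close>

lemma frattini_restrict_proper:
  assumes fin: "finite_length F L" and B: "lie_subalgebra F L B" and "B \<noteq> {\<zero>\<^bsub>L\<^esub>}"
  shows "\<not> B \<subseteq> frattini F (lie_restrict L B)"
proof
  assume sub: "B \<subseteq> frattini F (lie_restrict L B)"
  note B' = lie_subalgebra_imp[OF B]
  interpret B: lie_algebra F "lie_restrict L B" using B by (rule lie_algebra_restrict)
  have "{\<zero>\<^bsub>L\<^esub>} \<noteq> carrier (lie_restrict L B)" using assms(3) by auto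
  moreover have "lie_subalgebra F (lie_restrict L B) {\<zero>\<^bsub>L\<^esub>}"
    using B.lie_ideal_imp_subalgebra[OF B.lie_ideal_zero] by simp
  ultimately obtain M where M: "maximal_lie_subalgebra F (lie_restrict L B) M"
    using B.maximal_lie_subalgebra_exists[OF finite_length_restrict[OF fin B'(1)]] by blast
  then have "B \<subseteq> M" using sub unfolding frattini_def by blast
  then show False using M unfolding maximal_lie_subalgebra_restrict_iff[OF B] by blast
qed

text \<open>Testing N_{n-1} alone settles minimality because the series increases; n \<ge> 1 makes n
  - 1 a genuine predecessor.\<close>

lemma nilpotent_length_eq_iff:
  assumes fin: "finite_length F L" and n: "n \<ge> 1"
  shows "(\<exists>m. upper_nilpotent_series F L m = carrier L) \<and> nilpotent_length F L = n \<longleftrightarrow>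
    upper_nilpotent_series F L n = carrier L \<and> upper_nilpotent_series F L (n - 1) \<noteq> carrier L"
    (is "?lhs \<longleftrightarrow> ?rhs")
proof
  let ?P = "\<lambda>m. upper_nilpotent_series F L m = carrier L"
  assume ?lhs
  then have ex: "\<exists>m. ?P m" and len: "(LEAST m. ?P m) = n" unfolding nilpotent_length_def by auto
  have "n - 1 < (LEAST m. ?P m)" using n len by simp
  then show ?rhs using LeastI_ex[OF ex] not_less_Least[of "n - 1" ?P] unfolding len by blast
next
  assume r: ?rhs
  have "n \<le> m" if m: "upper_nilpotent_series F L m = carrier L" for m
  proof (rule ccontr)
    assume "\<not> n \<le> m"
    then have "carrier L \<subseteq> upper_nilpotent_series F L (n - 1)"
      using upper_nilpotent_series_mono[OF fin, of m "n - 1"] m by simp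
    then show False
      using r lie_ideal_imp(2)[OF lie_ideal_upper_nilpotent_series[OF fin]] by blast
  qed
  then have "nilpotent_length F L = n"
    unfolding nilpotent_length_def using r by (intro Least_equality) auto
  then show ?lhs using r by blast
qed

end

text \<open>Zero summands have to be excluded, since they would admit an n above the nilpotent
  length: for L = 0 and n = 1 the choice B_1 = 0 meets all other conditions, while L has length
  0.\<close>

theorem theorem2p15:
  fixes F :: "('a, 'c) ring_scheme"
    and L :: "('a, 'b, 'd) lie_algebra_scheme"
    and n :: nat
  assumes "lie_algebra F L"
    and "finite_dimensional F L"
    and "lie_solvable F L"
    and "n \<ge> 1"
  shows "L \<in> nilpotent_length_class F n \<longleftrightarrow>
    (\<exists>B :: nat \<Rightarrow> 'b set.
       (\<forall>i\<in>{1..n}. lie_subalgebra F L (B i) \<and> lie_nilpotent F (lie_restrict L (B i))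
          \<and> B i \<noteq> {\<zero>\<^bsub>L\<^esub>}) \<and>
       (\<forall>i\<in>{1..n}. upper_nilpotent_series F L i = subspace_sum L {1..i} B) \<and>
       carrier L = subspace_sum L {1..n} B \<and>
       (\<forall>i j. 1 \<le> i \<and> i \<le> j \<and> j \<le> n \<longrightarrow> lie_product F L (B i) (B j) \<subseteq> B i) \<and>
       (\<forall>i\<in>{1..n - 1}.
          let U = subspace_sum L {i + 1..n} B in
            upper_nilpotent_series F L i \<inter> U \<subseteq> frattini F (lie_restrict L U) \<and>
            frattini F (lie_restrict L U) = frattini_series F L (i + 1) \<inter> U))"
  (is "_ \<longleftrightarrow> (\<exists>B. ?D B)")
proof -
  interpret lie_algebra F L by (rule assms(1))
  let ?N = "upper_nilpotent_series F L"
  have fin: "finite_length F L"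
    using field_axioms assms(2) by (rule finite_dimensional_finite_length)
  have "L \<in> nilpotent_length_class F n \<longleftrightarrow> ?N n = carrier L \<and> ?N (n - 1) \<noteq> carrier L"
    unfolding nilpotent_length_class_def using nilpotent_length_eq_iff[OF fin assms(4)] assms(1-3)
    by blast
  also have "\<dots> \<longleftrightarrow> (\<exists>B. ?D B)"
  proof
    assume "?N n = carrier L \<and> ?N (n - 1) \<noteq> carrier L"
    then obtain B where B:
      "\<And>i. i \<in> {1..n} \<Longrightarrow> lie_subalgebra F L (B i)"
      "\<And>i. i \<in> {1..n} \<Longrightarrow> lie_nilpotent F (lie_restrict L (B i))"
      "\<And>i. i \<in> {1..n} \<Longrightarrow> B i \<noteq> {\<zero>\<^bsub>L\<^esub>}"
      "\<And>i. ?N i = subspace_sum L {1..i} B"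
      "\<And>i j. 1 \<le> i \<Longrightarrow> i \<le> j \<Longrightarrow> lie_product F L (B i) (B j) \<subseteq> B i"
      and supp: "\<And>i. i < n \<Longrightarrow> frattini_supplement i (subspace_sum L {i + 1..n} B)"
      and Nn: "?N n = carrier L"
      using nilpotent_decomposition[OF fin assms(4)] by metis
    have "?D B"
      unfolding Let_def
    proof (intro conjI ballI allI impI)
      show "carrier L = subspace_sum L {1..n} B" using B(4) Nn by metis
      show "lie_product F L (B i) (B j) \<subseteq> B i" if "1 \<le> i \<and> i \<le> j \<and> j \<le> n" for i j
        using that B(5) by blast
      fix i assume "i \<in> {1..n - 1}"
      then have "i < n" by auto
      note frattini_supplement_frattini_series[OF fin supp[OF this]]
      then show "?N i \<inter> subspace_sum L {i + 1..n} B \<subseteq> frattini F (lie_restrict L (subspace_sum L {i + 1..n} B))"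
        and "frattini F (lie_restrict L (subspace_sum L {i + 1..n} B)) =
          frattini_series F L (i + 1) \<inter> subspace_sum L {i + 1..n} B" by blast+
    qed (use B in blast)+
    then show "\<exists>B. ?D B" by blast
  next
    assume "\<exists>B. ?D B"
    then obtain B where D: "?D B" by blast
    then have Bn: "lie_subalgebra F L (B n)" "B n \<noteq> {\<zero>\<^bsub>L\<^esub>}" using assms(4) by auto
    have "?N n = carrier L" using D assms(4) by auto
    moreover have "?N (n - 1) \<noteq> carrier L"
    proof
      assume N1: "?N (n - 1) = carrier L"
      show False
      \<comment> \<open>For n = 1 condition (iv) is empty, and N_0 = 0 = L contradicts B_n \<noteq>
        0 directly.\<close>
      proof (cases "n = 1")
        case True
        then have "carrier L = {\<zero>\<^bsub>L\<^esub>}" using N1 by simp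
        then have "B n = {\<zero>\<^bsub>L\<^esub>}"
          using lie_subalgebra_imp(2)[OF Bn(1)] submodule_imp(2)[OF lie_subalgebra_imp(1)[OF Bn(1)]]
          by blast
        then show False using Bn(2) by contradiction
      next
        case False
        \<comment> \<open>Condition (iv) is applied at the last index i = n - 1, where the tail sum
          is B_n alone; with N_{n-1} = L it places B_n inside its own Frattini subalgebra.\<close>
        then have n1: "n - 1 \<in> {1..n - 1}" "n - 1 + 1 = n" using assms(4) by auto
        have "subspace_sum L {n..n} B = B n"
          using subspace_sum_singleton[of B n] lie_subalgebra_imp(2)[OF Bn(1)] by simp
        then have "?N (n - 1) \<inter> B n \<subseteq> frattini F (lie_restrict L (B n))"
          using D n1 unfolding Let_def by metis
        then show False
          using frattini_restrict_proper[OF fin Bn] N1 lie_subalgebra_imp(2)[OF Bn(1)] by blast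
      qed
    qed
    ultimately show "?N n = carrier L \<and> ?N (n - 1) \<noteq> carrier L" by blast
  qed
  finally show ?thesis .
qed

end
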